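(* Let $(A,\lhd,\rhd)$ be a finite-dimensional pre-Novikov algebra over $\mathbf{k}$ and $(A,\circ)$ the associated Novikov algebra. Let $\widetilde{A}:=A\ltimes_{L_\rhd^*+R_\lhd^*,-R_\lhd^*}A^*$ be the semi-direct product Novikov algebra. Let $(B,\diamond,(\cdot,\cdot))$ be a quadratic $\mathbb{Z}$-graded right Novikov algebra, and let $L=\widetilde{A}\otimes B$ be the induced Lie algebra. Then $(L,(\cdot,\cdot)_L)$, with $$(u_1\otimes b_1,u_2\otimes b_2)_L=\omega(u_1,u_2)(b_1,b_2)\qquad\text{for all }u_1,u_2\in\widetilde{A},\ b_1,b_2\in B,$$ where $\omega(a+f,b+g)=\langle g,a\rangle-\langle f,b\rangle$ for $a,b\in A$, $f,g\in A^*$, is a quasi-Frobenius $\mathbb{Z}$-graded Lie algebra.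
   Context: $\mathbf{k}$ is a field of characteristic zero. A Novikov algebra $(A,\circ)$: $(a\circ b)\circ c-a\circ(b\circ c)=(b\circ a)\circ c-b\circ(a\circ c)$ and $(a\circ b)\circ c=(a\circ c)\circ b$. A pre-Novikov algebra is a vector space $A$ with operations $\lhd,\rhd$ such that for all $x,y,z$: $x\rhd(y\rhd z)=(x\rhd y+x\lhd y)\rhd z+y\rhd(x\rhd z)-(y\rhd x+y\lhd x)\rhd z$; $x\rhd(y\lhd z)=(x\rhd y)\lhd z+y\lhd(x\lhd z+x\rhd z)-(y\lhd x)\lhd z$; $(x\lhd y+x\rhd y)\rhd z=(x\rhd z)\lhd y$; $(x\lhd y)\lhd z=(x\lhd z)\lhd y$. Its associated Novikov algebra is $(A,\circ)$, $x\circ y=x\lhd y+x\rhd y$. Put $L_\rhd(a)b=a\rhd b$, $R_\lhd(a)b=b\lhd a$, and $\langle\varphi^*(a)f,b\rangle=-\langle f,\varphi(a)b\rangle$ for $\varphi:A\to\mathrm{End}(A)$. $\widetilde{A}$ is $A\oplus A^*$ with product $(a+f)\circ(b+g)=a\circ b+(L_\rhd^*+R_\lhd^* )(a)g-R_\lhd^*(b)f$. A right Novikov algebra $(B,\diamond)$: $(a\diamond b)\diamond c-a\diamond(b\diamond c)=(a\diamond c)\diamond b-a\diamond(c\diamond b)$ and $a\diamond(b\diamond c)=b\diamond(a\diamond c)$. A bilinear form on a $\mathbb{Z}$-graded space is graded if for some $m\in\mathbb{Z}$ the components of degrees $i,j$ are orthogonal whenever $i+j+m\neq0$. Quadratic $\mathbb{Z}$-graded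 right Novikov algebra: $B=\oplus_{i\in\mathbb{Z}}B_i$, each $B_i$ finite-dimensional, $B_i\diamond B_j\subset B_{i+j}$, with a symmetric nondegenerate graded bilinear form satisfying $(a\diamond b,c)=-(a,b\diamond c+c\diamond b)$. Induced Lie algebra: $[u_1\otimes b_1,u_2\otimes b_2]=u_1\circ u_2\otimes b_1\diamond b_2-u_2\circ u_1\otimes b_2\diamond b_1$, graded by $L_i=\widetilde{A}\otimes B_i$. A quasi-Frobenius $\mathbb{Z}$-graded Lie algebra is a $\mathbb{Z}$-graded Lie algebra $L=\oplus L_i$ (each $L_i$ finite-dimensional, $[L_i,L_j]\subset L_{i+j}$) with a skewsymmetric nondegenerate graded bilinear form satisfying $([a,b],c)_L+([c,a],b)_L+([b,c],a)_L=0$ for all $a,b,c\in L$. *)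

theory Defs
  imports Complex_Main "HOL-Library.Function_Algebras" "HOL-Library.Product_Plus"
begin

section \<open>Linear algebra on subspaces\<close>

text \<open>A vector space is either a whole type with a scaling satisfying \<^locale>\<open>vector_space\<close>, or
  a subspace of such a type. Function types carry the pointwise addition of
  \<^theory>\<open>HOL-Library.Function_Algebras\<close> and products the componentwise one.\<close>

definition fscale :: "'k::field \<Rightarrow> ('x \<Rightarrow> 'k) \<Rightarrow> 'x \<Rightarrow> 'k"
  where "fscale c f = (\<lambda>x. c * f x)"

definition pscale :: "('k \<Rightarrow> 'a \<Rightarrow> 'a) \<Rightarrow> ('k \<Rightarrow> 'b \<Rightarrow> 'b) \<Rightarrow> 'k \<Rightarrow> 'a \<times> 'b \<Rightarrow> 'a \<times> 'b"
  where "pscale sA sB c p = (sA c (fst p), sB c (snd p))"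

definition finite_dimensional_on :: "('k::field \<Rightarrow> 'a::ab_group_add \<Rightarrow> 'a) \<Rightarrow> 'a set \<Rightarrow> bool"
  where "finite_dimensional_on s V \<longleftrightarrow> (\<exists>S. finite S \<and> module.span s S = V)"

definition bilinear_on ::
  "('k::field \<Rightarrow> 'u::ab_group_add \<Rightarrow> 'u) \<Rightarrow> 'u set \<Rightarrow> ('k \<Rightarrow> 'v::ab_group_add \<Rightarrow> 'v) \<Rightarrow> 'v set \<Rightarrow>
   ('k \<Rightarrow> 'w::ab_group_add \<Rightarrow> 'w) \<Rightarrow> ('u \<Rightarrow> 'v \<Rightarrow> 'w) \<Rightarrow> bool"
  where "bilinear_on sU U sV V sW g \<longleftrightarrow>
    (\<forall>x\<in>U. \<forall>y\<in>U. \<forall>v\<in>V. g (x + y) v = g x v + g y v) \<and>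
    (\<forall>c. \<forall>x\<in>U. \<forall>v\<in>V. g (sU c x) v = sW c (g x v)) \<and>
    (\<forall>x\<in>U. \<forall>v\<in>V. \<forall>w\<in>V. g x (v + w) = g x v + g x w) \<and>
    (\<forall>c. \<forall>x\<in>U. \<forall>v\<in>V. g x (sV c v) = sW c (g x v))"

definition nondegenerate_on :: "'v set \<Rightarrow> ('v::zero \<Rightarrow> 'v \<Rightarrow> 'k::zero) \<Rightarrow> bool"
  where "nondegenerate_on V B \<longleftrightarrow>
    (\<forall>x\<in>V. (\<forall>y\<in>V. B x y = 0) \<longrightarrow> x = 0) \<and> (\<forall>y\<in>V. (\<forall>x\<in>V. B x y = 0) \<longrightarrow> y = 0)"

definition dual_space :: "('k::field \<Rightarrow> 'a::ab_group_add \<Rightarrow> 'a) \<Rightarrow> ('a \<Rightarrow> 'k) set"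
  where "dual_space s = {f. Vector_Spaces.linear s (*) f}"


section \<open>Graded spaces\<close>

text \<open>\<open>V\<close> is the internal direct sum of the family \<open>Vs\<close> of finite-dimensional subspaces.\<close>

definition graded_space ::
  "('k::field \<Rightarrow> 'v::ab_group_add \<Rightarrow> 'v) \<Rightarrow> 'v set \<Rightarrow> (int \<Rightarrow> 'v set) \<Rightarrow> bool"
  where "graded_space s V Vs \<longleftrightarrow>
    (\<forall>i. module.subspace s (Vs i) \<and> Vs i \<subseteq> V \<and> finite_dimensional_on s (Vs i)) \<and>
    (\<forall>v\<in>V. \<exists>!f. (\<forall>i. f i \<in> Vs i) \<and> finite {i. f i \<noteq> 0} \<and> v = (\<Sum>i | f i \<noteq> 0. f i))"

definition graded_mult :: "(int \<Rightarrow> 'v set) \<Rightarrow> ('v \<Rightarrow> 'v \<Rightarrow> 'v) \<Rightarrow> bool"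
  where "graded_mult Vs p \<longleftrightarrow> (\<forall>i j. \<forall>x\<in>Vs i. \<forall>y\<in>Vs j. p x y \<in> Vs (i + j))"

definition graded_form :: "(int \<Rightarrow> 'v set) \<Rightarrow> ('v \<Rightarrow> 'v \<Rightarrow> 'k::zero) \<Rightarrow> bool"
  where "graded_form Vs B \<longleftrightarrow>
    (\<exists>m. \<forall>i j. i + j + m \<noteq> 0 \<longrightarrow> (\<forall>x\<in>Vs i. \<forall>y\<in>Vs j. B x y = 0))"


section \<open>Pre-Novikov algebras and the semi-direct product\<close>

locale pre_novikov_algebra = vector_space scale
  for scale :: "'k::field_char_0 \<Rightarrow> 'a::ab_group_add \<Rightarrow> 'a" +
  fixes lhd :: "'a \<Rightarrow> 'a \<Rightarrow> 'a" (infixl \<open>\<lhd>\<close> 70)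
    and rhd :: "'a \<Rightarrow> 'a \<Rightarrow> 'a" (infixl \<open>\<rhd>\<close> 70)
  assumes bilinear_lhd: "bilinear_on scale UNIV scale UNIV scale (\<lhd>)"
    and bilinear_rhd: "bilinear_on scale UNIV scale UNIV scale (\<rhd>)"
    and rhd_rhd: "x \<rhd> (y \<rhd> z) =
      (x \<rhd> y + x \<lhd> y) \<rhd> z + y \<rhd> (x \<rhd> z) - (y \<rhd> x + y \<lhd> x) \<rhd> z"
    and rhd_lhd: "x \<rhd> (y \<lhd> z) =
      (x \<rhd> y) \<lhd> z + y \<lhd> (x \<lhd> z + x \<rhd> z) - (y \<lhd> x) \<lhd> z"
    and sum_rhd: "(x \<lhd> y + x \<rhd> y) \<rhd> z = (x \<rhd> z) \<lhd> y"
    and lhd_lhd: "(x \<lhd> y) \<lhd> z = (x \<lhd> z) \<lhd> y"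

definition assoc_novikov :: "('a::plus \<Rightarrow> 'a \<Rightarrow> 'a) \<Rightarrow> ('a \<Rightarrow> 'a \<Rightarrow> 'a) \<Rightarrow> 'a \<Rightarrow> 'a \<Rightarrow> 'a"
  where "assoc_novikov lhd rhd x y = lhd x y + rhd x y"

text \<open>\<open>dual_rep \<phi> a\<close> is \<open>\<phi>\<^sup>*(a)\<close>, with the sign convention
  \<open>\<langle>\<phi>\<^sup>*(a)f, b\<rangle> = - \<langle>f, \<phi>(a)b\<rangle>\<close>.\<close>

definition dual_rep :: "('a \<Rightarrow> 'a \<Rightarrow> 'a) \<Rightarrow> 'a \<Rightarrow> ('a \<Rightarrow> 'k::ab_group_add) \<Rightarrow> 'a \<Rightarrow> 'k"
  where "dual_rep \<phi> a f = (\<lambda>b. - f (\<phi> a b))"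

definition left_mult :: "('a \<Rightarrow> 'a \<Rightarrow> 'a) \<Rightarrow> 'a \<Rightarrow> 'a \<Rightarrow> 'a"
  where "left_mult p a b = p a b"

definition right_mult :: "('a \<Rightarrow> 'a \<Rightarrow> 'a) \<Rightarrow> 'a \<Rightarrow> 'a \<Rightarrow> 'a"
  where "right_mult p a b = p b a"

definition semidirect_space :: "('k::field \<Rightarrow> 'a::ab_group_add \<Rightarrow> 'a) \<Rightarrow> ('a \<times> ('a \<Rightarrow> 'k)) set"
  where "semidirect_space s = UNIV \<times> dual_space s"

definition semidirect_mult ::
  "('a::ab_group_add \<Rightarrow> 'a \<Rightarrow> 'a) \<Rightarrow> ('a \<Rightarrow> 'a \<Rightarrow> 'a) \<Rightarrow>
   'a \<times> ('a \<Rightarrow> 'k::field) \<Rightarrow> 'a \<times> ('a \<Rightarrow> 'k) \<Rightarrow> 'a \<times> ('a \<Rightarrow> 'k)"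
  where "semidirect_mult lhd rhd = (\<lambda>(a, f) (b, g).
    (assoc_novikov lhd rhd a b,
     dual_rep (left_mult rhd) a g + dual_rep (right_mult lhd) a g - dual_rep (right_mult lhd) b f))"

definition omega :: "'a \<times> ('a \<Rightarrow> 'k) \<Rightarrow> 'a \<times> ('a \<Rightarrow> 'k) \<Rightarrow> 'k::ab_group_add"
  where "omega = (\<lambda>(a, f) (b, g). g a - f b)"


section \<open>Quadratic graded right Novikov algebras\<close>

locale quadratic_graded_right_novikov_algebra = vector_space scale
  for scale :: "'k::field_char_0 \<Rightarrow> 'b::ab_group_add \<Rightarrow> 'b" +
  fixes Bs :: "int \<Rightarrow> 'b set"
    and dia :: "'b \<Rightarrow> 'b \<Rightarrow> 'b" (infixl \<open>\<diamondop>\<close> 70)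
    and form :: "'b \<Rightarrow> 'b \<Rightarrow> 'k"
  assumes bilinear_dia: "bilinear_on scale UNIV scale UNIV scale (\<diamondop>)"
    and right_symmetric: "(a \<diamondop> b) \<diamondop> c - a \<diamondop> (b \<diamondop> c) = (a \<diamondop> c) \<diamondop> b - a \<diamondop> (c \<diamondop> b)"
    and left_commutative: "a \<diamondop> (b \<diamondop> c) = b \<diamondop> (a \<diamondop> c)"
    and graded_space: "graded_space scale UNIV Bs"
    and graded_dia: "graded_mult Bs (\<diamondop>)"
    and bilinear_form: "bilinear_on scale UNIV scale UNIV (*) form"
    and symmetric_form: "form a b = form b a"
    and nondegenerate_form: "nondegenerate_on UNIV form"
    and graded_form: "graded_form Bs form"
    and invariant_form: "form (a \<diamondop> b) c = - form a (b \<diamondop> c + c \<diamondop> b)"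


section \<open>Quasi-Frobenius graded Lie algebras\<close>

locale quasi_frobenius_graded_lie_algebra = vector_space scale
  for scale :: "'k::field_char_0 \<Rightarrow> 'l::ab_group_add \<Rightarrow> 'l" +
  fixes L :: "'l set"
    and Ls :: "int \<Rightarrow> 'l set"
    and bracket :: "'l \<Rightarrow> 'l \<Rightarrow> 'l"
    and form :: "'l \<Rightarrow> 'l \<Rightarrow> 'k"
  assumes subspace: "subspace L"
    and bracket_closed: "\<lbrakk>x \<in> L; y \<in> L\<rbrakk> \<Longrightarrow> bracket x y \<in> L"
    and bilinear_bracket: "bilinear_on scale L scale L scale bracket"
    and bracket_self: "x \<in> L \<Longrightarrow> bracket x x = 0"
    and jacobi: "\<lbrakk>x \<in> L; y \<in> L; z \<in> L\<rbrakk> \<Longrightarrow>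
      bracket x (bracket y z) + bracket y (bracket z x) + bracket z (bracket x y) = 0"
    and graded_space: "graded_space scale L Ls"
    and graded_bracket: "graded_mult Ls bracket"
    and bilinear_form: "bilinear_on scale L scale L (*) form"
    and skewsymmetric_form: "\<lbrakk>x \<in> L; y \<in> L\<rbrakk> \<Longrightarrow> form x y = - form y x"
    and nondegenerate_form: "nondegenerate_on L form"
    and graded_form: "graded_form Ls form"
    and closed_form: "\<lbrakk>a \<in> L; b \<in> L; c \<in> L\<rbrakk> \<Longrightarrow>
      form (bracket a b) c + form (bracket c a) b + form (bracket b c) a = 0"


section \<open>Tensor products\<close>

text \<open>\<open>U \<otimes> V\<close> is realised inside the dual of the space of bilinear forms on \<open>U \<times> V\<close>: the pure
  tensor \<open>u \<otimes> v\<close> is evaluation at \<open>(u, v)\<close>, and \<open>U \<otimes> V\<close> is the span of the pure tensors. The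
  universal property is proved below (\<open>tensor_universal\<close>, \<open>tensor_universal_unique\<close>).\<close>

type_synonym ('u, 'v, 'k) tensor = "('u \<Rightarrow> 'v \<Rightarrow> 'k) \<Rightarrow> 'k"

definition pure_tensor ::
  "('k::field \<Rightarrow> 'u::ab_group_add \<Rightarrow> 'u) \<Rightarrow> 'u set \<Rightarrow> ('k \<Rightarrow> 'v::ab_group_add \<Rightarrow> 'v) \<Rightarrow> 'v set \<Rightarrow>
   'u \<Rightarrow> 'v \<Rightarrow> ('u, 'v, 'k) tensor"
  where "pure_tensor sU U sV V u v = (\<lambda>\<beta>. if bilinear_on sU U sV V (*) \<beta> then \<beta> u v else 0)"

text \<open>For subspaces \<open>U' \<subseteq> U\<close> and \<open>V' \<subseteq> V\<close>, the subspace \<open>U' \<otimes> V'\<close> of \<open>U \<otimes> V\<close>.\<close>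

definition tensor_subspace ::
  "('k::field \<Rightarrow> 'u::ab_group_add \<Rightarrow> 'u) \<Rightarrow> 'u set \<Rightarrow> ('k \<Rightarrow> 'v::ab_group_add \<Rightarrow> 'v) \<Rightarrow> 'v set \<Rightarrow>
   'u set \<Rightarrow> 'v set \<Rightarrow> ('u, 'v, 'k) tensor set"
  where "tensor_subspace sU U sV V U' V' =
    module.span fscale {pure_tensor sU U sV V u v | u v. u \<in> U' \<and> v \<in> V'}"

abbreviation tensor_space ::
  "('k::field \<Rightarrow> 'u::ab_group_add \<Rightarrow> 'u) \<Rightarrow> 'u set \<Rightarrow> ('k \<Rightarrow> 'v::ab_group_add \<Rightarrow> 'v) \<Rightarrow> 'v set \<Rightarrow>
   ('u, 'v, 'k) tensor set"
  where "tensor_space sU U sV V \<equiv> tensor_subspace sU U sV V U V"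

text \<open>For \<open>h\<close> linear in each of its four arguments, \<open>tensor_ext\<close> is the bilinear form on
  \<open>U \<otimes> V\<close> with \<open>(u\<^sub>1 \<otimes> v\<^sub>1, u\<^sub>2 \<otimes> v\<^sub>2) \<mapsto> h u\<^sub>1 v\<^sub>1 u\<^sub>2 v\<^sub>2\<close> (lemma \<open>tensor_ext_pure\<close>): a tensor is a
  functional on bilinear forms, applied here to one pair of arguments at a time.\<close>

definition tensor_ext ::
  "('u \<Rightarrow> 'v \<Rightarrow> 'u \<Rightarrow> 'v \<Rightarrow> 'k) \<Rightarrow> ('u, 'v, 'k) tensor \<Rightarrow> ('u, 'v, 'k) tensor \<Rightarrow> 'k"
  where "tensor_ext h s t = s (\<lambda>u1 v1. t (\<lambda>u2 v2. h u1 v1 u2 v2))"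

definition tensor_form ::
  "('u \<Rightarrow> 'u \<Rightarrow> 'k::times) \<Rightarrow> ('v \<Rightarrow> 'v \<Rightarrow> 'k) \<Rightarrow> ('u, 'v, 'k) tensor \<Rightarrow> ('u, 'v, 'k) tensor \<Rightarrow> 'k"
  where "tensor_form p q = tensor_ext (\<lambda>u1 v1 u2 v2. p u1 u2 * q v1 v2)"

text \<open>The bilinear extension of
  \<open>[u\<^sub>1 \<otimes> v\<^sub>1, u\<^sub>2 \<otimes> v\<^sub>2] = u\<^sub>1 \<circ> u\<^sub>2 \<otimes> v\<^sub>1 \<diamondop> v\<^sub>2 - u\<^sub>2 \<circ> u\<^sub>1 \<otimes> v\<^sub>2 \<diamondop> v\<^sub>1\<close>,
  evaluated at each \<open>\<beta>\<close>.\<close>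

definition induced_bracket ::
  "('k::field \<Rightarrow> 'u::ab_group_add \<Rightarrow> 'u) \<Rightarrow> 'u set \<Rightarrow> ('k \<Rightarrow> 'v::ab_group_add \<Rightarrow> 'v) \<Rightarrow> 'v set \<Rightarrow>
   ('u \<Rightarrow> 'u \<Rightarrow> 'u) \<Rightarrow> ('v \<Rightarrow> 'v \<Rightarrow> 'v) \<Rightarrow>
   ('u, 'v, 'k) tensor \<Rightarrow> ('u, 'v, 'k) tensor \<Rightarrow> ('u, 'v, 'k) tensor"
  where "induced_bracket sU U sV V circ dia s t = (\<lambda>\<beta>. tensor_ext (\<lambda>u1 v1 u2 v2.
    (pure_tensor sU U sV V (circ u1 u2) (dia v1 v2)
      - pure_tensor sU U sV V (circ u2 u1) (dia v2 v1)) \<beta>) s t)"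

lemma vector_space_fscale: "vector_space (fscale :: 'k::field \<Rightarrow> ('x \<Rightarrow> 'k) \<Rightarrow> _)"
  by unfold_locales (auto simp: fscale_def fun_eq_iff algebra_simps)

lemma vector_space_pscale:
  assumes "vector_space sA" "vector_space sB"
  shows "vector_space (pscale sA sB)"
proof -
  interpret A: vector_space sA by fact
  interpret B: vector_space sB by fact
  show ?thesis
    by unfold_locales
      (auto simp: pscale_def prod_eq_iff A.scale_right_distrib B.scale_right_distrib
        A.scale_left_distrib B.scale_left_distrib)
qed

lemma vector_space_times: "vector_space ((*) :: 'k::field \<Rightarrow> 'k \<Rightarrow> 'k)"
  by unfold_locales (auto simp: algebra_simps)

lemma bilinear_on_pure_tensor:
  "bilinear_on sU U sV V fscale (pure_tensor sU U sV V)"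
  by (auto simp: bilinear_on_def pure_tensor_def fscale_def fun_eq_iff)

lemma tensor_ext_pure:
  assumes "\<And>u v. \<lbrakk>u \<in> U; v \<in> V\<rbrakk> \<Longrightarrow> bilinear_on sU U sV V (*) (h u v)"
    and "\<And>u v. \<lbrakk>u \<in> U; v \<in> V\<rbrakk> \<Longrightarrow> bilinear_on sU U sV V (*) (\<lambda>u1 v1. h u1 v1 u v)"
    and UV: "u1 \<in> U" "v1 \<in> V" "u2 \<in> U" "v2 \<in> V"
    and closed: "module.subspace sU U" "module.subspace sV V" "vector_space sU" "vector_space sV"
  shows "tensor_ext h (pure_tensor sU U sV V u1 v1) (pure_tensor sU U sV V u2 v2) = h u1 v1 u2 v2"
proof -
  interpret U: vector_space sU by fact
  interpret V: vector_space sV by fact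
  let ?g = "\<lambda>u v. pure_tensor sU U sV V u2 v2 (h u v)"
  have g: "?g u v = h u v u2 v2" if "u \<in> U" "v \<in> V" for u v
    using assms(1)[OF that] by (simp add: pure_tensor_def)
  note cl = U.subspace_add[OF closed(1)] U.subspace_scale[OF closed(1)]
    V.subspace_add[OF closed(2)] V.subspace_scale[OF closed(2)]
  have "bilinear_on sU U sV V (*) ?g"
    using assms(2)[OF UV(3,4)] unfolding bilinear_on_def by (simp add: g cl)
  then show ?thesis
    using g UV by (simp add: tensor_ext_def pure_tensor_def[of _ _ _ _ u1 v1])
qed

lemma tensor_universal:
  fixes sU :: "'k::field \<Rightarrow> 'u::ab_group_add \<Rightarrow> 'u" and sV :: "'k \<Rightarrow> 'v::ab_group_add \<Rightarrow> 'v"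
    and sW :: "'k \<Rightarrow> 'w::ab_group_add \<Rightarrow> 'w"
  assumes W: "vector_space sW" and g: "bilinear_on sU U sV V sW g"
  shows "\<exists>h. Vector_Spaces.linear fscale sW h \<and>
    (\<forall>u\<in>U. \<forall>v\<in>V. h (pure_tensor sU U sV V u v) = g u v)"
proof -
  interpret T: vector_space "fscale :: 'k \<Rightarrow> ('u, 'v, 'k) tensor \<Rightarrow> _" by (rule vector_space_fscale)
  interpret W: vector_space sW by fact
  interpret K: vector_space "(*) :: 'k \<Rightarrow> 'k \<Rightarrow> 'k" by (rule vector_space_times)
  interpret TW: vector_space_pair "fscale :: 'k \<Rightarrow> ('u, 'v, 'k) tensor \<Rightarrow> _" sW by unfold_locales
  interpret WK: vector_space_pair sW "(*) :: 'k \<Rightarrow> 'k \<Rightarrow> 'k" by unfold_locales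
  have separate: "w = 0" if "\<And>\<phi>. Vector_Spaces.linear sW (*) \<phi> \<Longrightarrow> \<phi> w = 0" for w
  proof (rule ccontr)
    assume "w \<noteq> 0"
    then have "\<not> W.dependent {w}" by simp
    from WK.linear_independent_extend[OF this, of "\<lambda>_. 1"] that show False by force
  qed
  let ?pt = "pure_tensor sU U sV V"
  let ?P = "(\<lambda>(u, v). ?pt u v) ` (U \<times> V)"
  obtain Bs where Bs: "Bs \<subseteq> ?P" "T.independent Bs" "?P \<subseteq> T.span Bs"
    using T.maximal_independent_subset by metis
  have "\<forall>b\<in>Bs. \<exists>p. p \<in> U \<times> V \<and> b = ?pt (fst p) (snd p)"
    using Bs(1) by fastforce
  then obtain r where r: "\<And>b. b \<in> Bs \<Longrightarrow> r b \<in> U \<times> V \<and> b = ?pt (fst (r b)) (snd (r b))"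
    by metis
  obtain h where h: "Vector_Spaces.linear fscale sW h"
      "\<And>b. b \<in> Bs \<Longrightarrow> h b = g (fst (r b)) (snd (r b))"
    using TW.linear_independent_extend[OF Bs(2), of "\<lambda>b. g (fst (r b)) (snd (r b))"] by blast
  interpret h: Vector_Spaces.linear fscale sW h by fact
  have "h (?pt u v) = g u v" if uv: "u \<in> U" "v \<in> V" for u v
  proof -
    have "h (?pt u v) - g u v = 0"
    proof (rule separate)
      fix \<phi> assume "Vector_Spaces.linear sW (*) \<phi>"
      then interpret \<phi>: Vector_Spaces.linear sW "(*)" \<phi> .
      let ?\<beta> = "\<lambda>u v. \<phi> (g u v)"
      have \<beta>: "bilinear_on sU U sV V (*) ?\<beta>"
        using g by (simp add: bilinear_on_def \<phi>.add \<phi>.scale)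
      have "\<phi> (h t) = t ?\<beta>" if "t \<in> T.span Bs" for t
        using that
      proof (induction rule: T.span_induct_alt)
        case base
        have "h 0 = 0" by (rule h.zero)
        then show ?case by (simp add: \<phi>.zero zero_fun_def)
      next
        case (step c x y)
        have "x ?\<beta> = \<phi> (h x)"
          using r[OF step(1)] h(2)[OF step(1)] \<beta> by (metis pure_tensor_def)
        moreover have "h (fscale c x + y) = sW c (h x) + h y"
          by (simp only: h.add h.scale)
        ultimately show ?case using step(2)
          by (simp only: \<phi>.add \<phi>.scale) (simp add: fscale_def)
      qed
      moreover have "?pt u v \<in> T.span Bs" using Bs(3) uv by auto
      ultimately have "\<phi> (h (?pt u v)) = ?pt u v ?\<beta>" by blast
      then show "\<phi> (h (?pt u v) - g u v) = 0"
        using \<beta> by (simp add: \<phi>.diff pure_tensor_def)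
    qed
    then show ?thesis by simp
  qed
  with h(1) show ?thesis by blast
qed

lemma tensor_universal_unique:
  fixes sU :: "'k::field \<Rightarrow> 'u::ab_group_add \<Rightarrow> 'u" and sV :: "'k \<Rightarrow> 'v::ab_group_add \<Rightarrow> 'v"
    and sW :: "'k \<Rightarrow> 'w::ab_group_add \<Rightarrow> 'w"
  assumes "Vector_Spaces.linear fscale sW h" "Vector_Spaces.linear fscale sW h'"
    and "\<And>u v. \<lbrakk>u \<in> U; v \<in> V\<rbrakk> \<Longrightarrow> h (pure_tensor sU U sV V u v) = h' (pure_tensor sU U sV V u v)"
    and "t \<in> tensor_space sU U sV V"
  shows "h t = h' t"
proof -
  interpret h: Vector_Spaces.linear fscale sW h by fact
  interpret p: vector_space_pair "fscale :: 'k \<Rightarrow> ('u, 'v, 'k) tensor \<Rightarrow> _" sW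
    by unfold_locales
  show ?thesis
    by (rule p.linear_eq_on[OF assms(1,2) assms(4)[unfolded tensor_subspace_def]])
      (use assms(3) in auto)
qed

end

theory Submission
  imports Defs
begin

text \<open>
  Let \<open>A' = A \<oplus> A\<^sup>*\<close> be the semi-direct product. Its form \<open>\<omega>\<close> satisfies a Novikov
  analogue of the cocycle condition,
  \<open>\<omega>(x \<circ> y, z) - \<omega>(x \<circ> z + z \<circ> x, y) + \<omega>(z \<circ> y, x) = 0\<close> (\<open>omega_cocycle\<close>), and the theorem
  holds for every finite-dimensional Novikov algebra \<open>U\<close> with such a nondegenerate skewsymmetric form
  (\<open>quasi_frobenius_tensor_product\<close>). The reason is visible on pure tensors. Put
  \<open>t(a, b, c) = (a \<diamondop> b, c)\<close>. Invariance and symmetry of the form of \<open>B\<close> say that \<open>t\<close> is symmetric in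
  its last two arguments and that \<open>t(a, b, c) + t(b, c, a) + t(c, a, b) = 0\<close>. So the cyclic sum that
  must vanish involves three values of \<open>t\<close> with one linear relation between them; eliminating one
  value leaves two coefficients, and each is an instance of the cocycle condition for \<open>\<omega>\<close>.

  The Jacobi identity is the known fact that a Novikov algebra tensored with a right Novikov
  algebra is a Lie algebra: the two axioms on each side reduce the twelve terms of the Jacobi sum to
  tensors of three elements of \<open>U\<close> with three elements of \<open>B\<close>, and these cancel (\<open>jacobi_tens\<close>).
  That \<open>A'\<close> is a Novikov algebra amounts to the Novikov identities of \<open>A\<close> and, after transposing the
  action on \<open>A\<^sup>*\<close>, to identities in \<open>A\<close> for the operators \<open>L\<^sub>\<rhd>(a) + R\<^sub>\<lhd>(a)\<close> and \<open>R\<^sub>\<lhd>(a)\<close>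
  (\<open>M_commutator\<close>, \<open>M_lhd\<close>, \<open>M_nov\<close>, \<open>lhd_lhd\<close>).

  Nondegeneracy and the grading are statements about the tensor product itself. Expanding a tensor
  along a basis of the finite-dimensional \<open>U\<close> reduces nondegeneracy of the product form to that of
  the two factors (\<open>tensor_form_nondegenerate\<close>). The decomposition of \<open>U \<otimes> B\<close> comes from the
  projections of \<open>B\<close> onto its components, which the universal property lifts to the tensor
  product (\<open>graded_space_tensor\<close>).
\<close>


section \<open>Linear algebra\<close>

lemma bilinear_onD:
  assumes "bilinear_on sU U sV V sW g"
  shows "\<And>x y v. \<lbrakk>x \<in> U; y \<in> U; v \<in> V\<rbrakk> \<Longrightarrow> g (x + y) v = g x v + g y v"
    and "\<And>c x v. \<lbrakk>x \<in> U; v \<in> V\<rbrakk> \<Longrightarrow> g (sU c x) v = sW c (g x v)"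
    and "\<And>x v w. \<lbrakk>x \<in> U; v \<in> V; w \<in> V\<rbrakk> \<Longrightarrow> g x (v + w) = g x v + g x w"
    and "\<And>c x v. \<lbrakk>x \<in> U; v \<in> V\<rbrakk> \<Longrightarrow> g x (sV c v) = sW c (g x v)"
  using assms unfolding bilinear_on_def by blast+

lemma bilinear_on_left_sum:
  fixes sU :: "'k::field \<Rightarrow> 'u::ab_group_add \<Rightarrow> 'u" and sW :: "'k \<Rightarrow> 'w::ab_group_add \<Rightarrow> 'w"
  assumes g: "bilinear_on sU U sV V sW g" and sU: "vector_space sU" and U: "module.subspace sU U"
    and x: "\<And>i. i \<in> I \<Longrightarrow> x i \<in> U" and v: "v \<in> V"
  shows "g (\<Sum>i\<in>I. x i) v = (\<Sum>i\<in>I. g (x i) v)"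
proof -
  interpret U: vector_space sU by fact
  have 0: "g 0 v = 0"
    using bilinear_onD(1)[OF g U.subspace_0[OF U] U.subspace_0[OF U] v] by simp
  show ?thesis
    using x
  proof (induction I rule: infinite_finite_induct)
    case (insert i I)
    then have "(\<Sum>i\<in>I. x i) \<in> U" by (auto intro: U.subspace_sum[OF U])
    then show ?case
      using insert by (simp add: bilinear_onD(1)[OF g _ _ v])
  qed (simp_all add: 0)
qed

lemma bilinear_on_diff:
  fixes sU :: "'k::field \<Rightarrow> 'u::ab_group_add \<Rightarrow> 'u" and sV :: "'k \<Rightarrow> 'v::ab_group_add \<Rightarrow> 'v"
    and sW :: "'k \<Rightarrow> 'w::ab_group_add \<Rightarrow> 'w"
  assumes g: "bilinear_on sU U sV V sW g"
  assumes "vector_space sU" "module.subspace sU U" "vector_space sV" "module.subspace sV V"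
  shows "\<And>x y v. \<lbrakk>x \<in> U; y \<in> U; v \<in> V\<rbrakk> \<Longrightarrow> g (x - y) v = g x v - g y v"
    and "\<And>x v w. \<lbrakk>x \<in> U; v \<in> V; w \<in> V\<rbrakk> \<Longrightarrow> g x (v - w) = g x v - g x w"
proof -
  interpret U: vector_space sU by fact
  interpret V: vector_space sV by fact
  show "g (x - y) v = g x v - g y v" if "x \<in> U" "y \<in> U" "v \<in> V" for x y v
    using bilinear_onD(1)[OF g U.subspace_diff[OF assms(3) that(1,2)] that(2,3)] by simp
  show "g x (v - w) = g x v - g x w" if "x \<in> U" "v \<in> V" "w \<in> V" for x v w
    using bilinear_onD(3)[OF g that(1) V.subspace_diff[OF assms(5) that(2,3)] that(3)] by simp
qed

text \<open>An internal direct sum is the same thing as a family of linear projections, each of which kills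
  the other components, together with the fact that the components span. This lemma and the next
  one translate between the two descriptions; only the projections pass easily to a tensor
  product.\<close>

lemma graded_space_projections:
  assumes "vector_space s" and V: "graded_space s UNIV Vs"
  obtains P where "\<And>i. Vector_Spaces.linear s s (P i)"
    and "\<And>i x. P i x \<in> Vs i"
    and "\<And>i x. x \<in> Vs i \<Longrightarrow> P i x = x"
    and "\<And>i j x. \<lbrakk>x \<in> Vs j; i \<noteq> j\<rbrakk> \<Longrightarrow> P i x = 0"
    and "\<And>x. x \<in> module.span s (\<Union>i. Vs i)"
proof -
  interpret vector_space s by fact
  have sub: "subspace (Vs i)" for i using V by (auto simp: graded_space_def)
  note cl = subspace_add[OF sub] subspace_scale[OF sub] subspace_0[OF sub]
  let ?D = "\<lambda>v f. (\<forall>i. f i \<in> Vs i) \<and> finite {i. f i \<noteq> 0} \<and> v = (\<Sum>i | f i \<noteq> 0. f i)"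
  have ex: "\<exists>!f. ?D v f" for v using V by (auto simp: graded_space_def)
  define Q where "Q v = (THE f. ?D v f)" for v
  have D_Q: "?D v (Q v)" for v unfolding Q_def by (rule theI'[OF ex])
  have Q: "Q v i \<in> Vs i" "finite {i. Q v i \<noteq> 0}" for v i using D_Q by blast+
  have Q_sum: "(\<Sum>i | Q v i \<noteq> 0. Q v i) = v" for v using D_Q by simp
  have Q_eq: "Q v = f" if "?D v f" for v f
    unfolding Q_def by (rule the1_equality[where P = "?D v", OF ex that])
  have D_sum: "?D v f" if "finite S" "\<And>i. f i \<in> Vs i" "\<And>i. i \<notin> S \<Longrightarrow> f i = 0" "v = (\<Sum>i\<in>S. f i)"
    for S v f
  proof -
    have "{i. f i \<noteq> 0} \<subseteq> S" using that(3) by blast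
    then have "finite {i. f i \<noteq> 0}" "(\<Sum>i\<in>S. f i) = (\<Sum>i | f i \<noteq> 0. f i)"
      using that(1) by (auto intro: finite_subset sum.mono_neutral_right)
    with that(2,4) show ?thesis by (simp only: simp_thms)
  qed
  have sumQ: "v = (\<Sum>i\<in>S. Q v i)" if "finite S" "{i. Q v i \<noteq> 0} \<subseteq> S" for v S
  proof -
    have "v = (\<Sum>i | Q v i \<noteq> 0. Q v i)" by (rule Q_sum[symmetric])
    also have "\<dots> = (\<Sum>i\<in>S. Q v i)" by (rule sum.mono_neutral_left) (use that in auto)
    finally show ?thesis .
  qed
  have "Q (x + y) = (\<lambda>i. Q x i + Q y i)" for x y
  proof (rule Q_eq, rule D_sum)
    let ?S = "{i. Q x i \<noteq> 0} \<union> {i. Q y i \<noteq> 0}"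
    show fin: "finite ?S" using Q by blast
    have "x = (\<Sum>i\<in>?S. Q x i)" "y = (\<Sum>i\<in>?S. Q y i)"
      by (rule sumQ[OF fin], blast)+
    then show "x + y = (\<Sum>i\<in>?S. Q x i + Q y i)" by (simp only: sum.distrib)
  qed (use Q cl in auto)
  moreover have "Q (s c x) = (\<lambda>i. s c (Q x i))" for c x
  proof (rule Q_eq, rule D_sum)
    show "s c x = (\<Sum>i | Q x i \<noteq> 0. s c (Q x i))"
      by (simp only: scale_sum_right[symmetric] Q_sum)
  qed (use Q cl in auto)
  ultimately have lin: "Vector_Spaces.linear s s (\<lambda>v. Q v i)" for i
    by (simp add: Vector_Spaces.linear_iff vector_space_axioms)
  have homogeneous: "Q x = (\<lambda>i. if i = j then x else 0)" if "x \<in> Vs j" for x j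
    by (rule Q_eq, rule D_sum[of "{j}"]) (use that in \<open>auto simp: cl\<close>)
  have in_span: "x \<in> span (\<Union>i. Vs i)" for x
  proof -
    have "(\<Sum>i | Q x i \<noteq> 0. Q x i) \<in> span (\<Union>i. Vs i)"
      by (rule span_sum, rule span_base) (use Q in blast)
    then show ?thesis by (simp only: Q_sum)
  qed
  show ?thesis
    by (rule that[of "\<lambda>i v. Q v i", OF lin Q(1) _ _ in_span]) (simp_all add: homogeneous)
qed

lemma graded_space_of_projections:
  assumes "vector_space s"
    and Vs: "\<And>i. module.subspace s (Vs i)" "\<And>i. Vs i \<subseteq> V" "\<And>i. finite_dimensional_on s (Vs i)"
    and lin: "\<And>i. Vector_Spaces.linear s s (P i)"
    and same: "\<And>i x. x \<in> Vs i \<Longrightarrow> P i x = x"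
    and other: "\<And>i j x. \<lbrakk>x \<in> Vs j; i \<noteq> j\<rbrakk> \<Longrightarrow> P i x = 0"
    and span: "V \<subseteq> module.span s (\<Union>i. Vs i)"
  shows "graded_space s V Vs"
proof -
  interpret vector_space s by fact
  interpret P: Vector_Spaces.linear s s "P i" for i by (rule lin)
  have dec: "(\<forall>i. P i v \<in> Vs i) \<and> finite {i. P i v \<noteq> 0} \<and> v = (\<Sum>i | P i v \<noteq> 0. P i v)"
    if "v \<in> span (\<Union>i. Vs i)" for v
    using that
  proof (induction rule: span_induct_alt)
    case base
    show ?case by (simp add: P.zero subspace_0[OF Vs(1)])
  next
    case (step c x y)
    from step(1) obtain j where j: "x \<in> Vs j" by blast
    let ?S = "insert j {i. P i y \<noteq> 0}"
    have eq: "P i (s c x + y) = (if i = j then s c x else 0) + P i y" for i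
      using same[OF j] other[OF j] by (auto simp: P.add P.scale)
    have fin: "finite ?S" using step(2) by simp
    have supp: "{i. P i (s c x + y) \<noteq> 0} \<subseteq> ?S" by (auto simp: eq)
    have "(\<Sum>i | P i (s c x + y) \<noteq> 0. P i (s c x + y)) = (\<Sum>i\<in>?S. P i (s c x + y))"
      by (rule sum.mono_neutral_left[OF fin supp]) auto
    also have "\<dots> = s c x + (\<Sum>i\<in>?S. P i y)"
      using fin by (simp add: eq sum.distrib)
    also have "(\<Sum>i\<in>?S. P i y) = (\<Sum>i | P i y \<noteq> 0. P i y)"
      by (rule sum.mono_neutral_right[OF fin]) auto
    finally have "s c x + y = (\<Sum>i | P i (s c x + y) \<noteq> 0. P i (s c x + y))"
      using step(2) by simp
    moreover have "P i (s c x + y) \<in> Vs i" for i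
      using step(2) j by (auto simp: eq intro!: subspace_add[OF Vs(1)] subspace_scale[OF Vs(1)])
    ultimately show ?case using finite_subset[OF supp fin] by blast
  qed
  have uniq: "f = (\<lambda>i. P i v)"
    if f: "\<forall>i. f i \<in> Vs i" "finite {i. f i \<noteq> 0}" "v = (\<Sum>i | f i \<noteq> 0. f i)" for v f
  proof
    fix i
    have Pf: "P i (f j) = (if j = i then f i else 0)" for j
      using f(1) same[of "f i" i] other[of "f j" j i] by (cases "j = i") auto
    show "f i = P i v"
      using f(2) by (subst f(3)) (simp add: P.sum Pf)
  qed
  have "\<exists>!f. (\<forall>i. f i \<in> Vs i) \<and> finite {i. f i \<noteq> 0} \<and> v = (\<Sum>i | f i \<noteq> 0. f i)" if "v \<in> V" for v
  proof (rule ex1I[of _ "\<lambda>i. P i v"])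
    show "(\<forall>i. P i v \<in> Vs i) \<and> finite {i. P i v \<noteq> 0} \<and> v = (\<Sum>i | P i v \<noteq> 0. P i v)"
      using dec that span by (meson subsetD)
  qed (use uniq in blast)
  with Vs show ?thesis by (simp add: graded_space_def)
qed

text \<open>The coordinate functionals \<open>\<delta> b\<close> of a finite basis \<open>S\<close> span the dual, since a linear functional
  is determined by its values on \<open>S\<close>.\<close>

lemma finite_dimensional_dual_space:
  assumes "vector_space s" and fd: "finite_dimensional_on s (UNIV :: 'a::ab_group_add set)"
  shows "finite_dimensional_on fscale (dual_space (s :: 'k::field \<Rightarrow> 'a \<Rightarrow> 'a))"
proof -
  interpret vector_space s by fact
  interpret K: vector_space "(*) :: 'k \<Rightarrow> 'k \<Rightarrow> 'k" by (rule vector_space_times)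
  interpret F: vector_space "fscale :: 'k \<Rightarrow> ('a \<Rightarrow> 'k) \<Rightarrow> _" by (rule vector_space_fscale)
  interpret p: vector_space_pair s "(*) :: 'k \<Rightarrow> 'k \<Rightarrow> 'k" by unfold_locales
  obtain T where T: "finite T" "span T = UNIV" using fd by (auto simp: finite_dimensional_on_def)
  obtain S where S: "S \<subseteq> T" "independent S" "T \<subseteq> span S"
    using maximal_independent_subset[of T] by blast
  have finS: "finite S" using S T finite_subset by blast
  have spanS: "span S = UNIV" using S(3) T(2) span_mono[OF S(3)] by (auto simp: span_span)
  have "\<forall>b. \<exists>f. Vector_Spaces.linear s (*) f \<and> (\<forall>x\<in>S. f x = (if x = b then 1 else 0))"
    using p.linear_independent_extend[OF S(2), of "\<lambda>x. if x = b then 1 else 0" for b] by (intro allI)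
  then obtain \<delta> where \<delta>: "\<And>b. Vector_Spaces.linear s (*) (\<delta> b)"
      "\<And>b x. x \<in> S \<Longrightarrow> \<delta> b x = (if x = b then 1 else 0)"
    by metis
  have sub: "F.subspace (dual_space s)"
    by (auto simp: F.subspace_def dual_space_def fscale_def plus_fun_def zero_fun_def
        intro!: p.linear_zero p.linear_compose_add p.linear_compose_scale_right)
  have "f \<in> F.span (\<delta> ` S)" if "f \<in> dual_space s" for f
  proof -
    have f: "Vector_Spaces.linear s (*) f" using that by (simp add: dual_space_def)
    have "(\<Sum>b\<in>S. fscale (f b) (\<delta> b)) \<in> dual_space s"
      by (intro F.subspace_sum[OF sub] F.subspace_scale[OF sub]) (simp add: dual_space_def \<delta>)
    then have g: "Vector_Spaces.linear s (*) (\<Sum>b\<in>S. fscale (f b) (\<delta> b))"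
      by (simp add: dual_space_def)
    have app: "(\<Sum>b\<in>X. fscale (f b) (\<delta> b)) x = (\<Sum>b\<in>X. f b * \<delta> b x)" for x X
      by (induction X rule: infinite_finite_induct) (auto simp: fscale_def)
    have "f = (\<Sum>b\<in>S. fscale (f b) (\<delta> b))"
    proof
      fix x
      have "f x = (\<Sum>b\<in>S. fscale (f b) (\<delta> b)) x"
        by (rule p.linear_eq_on[OF f g, of _ S])
          (use spanS finS in \<open>auto simp: app \<delta>(2) if_distrib cong: if_cong\<close>)
      then show "f x = (\<Sum>b\<in>S. fscale (f b) (\<delta> b)) x" .
    qed
    moreover have "(\<Sum>b\<in>S. fscale (f b) (\<delta> b)) \<in> F.span (\<delta> ` S)"
      by (intro F.span_sum F.span_scale F.span_base imageI)
    ultimately show ?thesis by simp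
  qed
  moreover have "F.span (\<delta> ` S) \<subseteq> dual_space s"
    by (rule F.span_minimal) (use sub \<delta>(1) in \<open>auto simp: dual_space_def\<close>)
  ultimately have "F.span (\<delta> ` S) = dual_space s" by blast
  with finS show ?thesis unfolding finite_dimensional_on_def by blast
qed

lemma dual_space_separates:
  assumes "vector_space s" and "\<And>f. f \<in> dual_space s \<Longrightarrow> f x = 0"
  shows "x = 0"
proof (rule ccontr)
  interpret vector_space s by fact
  interpret K: vector_space "(*)" by (rule vector_space_times)
  interpret p: vector_space_pair s "(*)" by unfold_locales
  assume "x \<noteq> 0"
  then have "independent {x}" by simp
  from p.linear_independent_extend[OF this, of "\<lambda>_. 1"] assms(2) show False
    by (force simp: dual_space_def)
qed

lemma finite_dimensional_on_Times:
  assumes "vector_space sU" "vector_space sV"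
    and "finite_dimensional_on sU U" "finite_dimensional_on sV V"
  shows "finite_dimensional_on (pscale sU sV) (U \<times> V)"
proof -
  interpret U: vector_space sU by fact
  interpret V: vector_space sV by fact
  interpret P: vector_space "pscale sU sV" by (rule vector_space_pscale) fact+
  obtain S T where S: "finite S" "U.span S = U" and T: "finite T" "V.span T = V"
    using assms(3,4) by (auto simp: finite_dimensional_on_def)
  let ?G = "(\<lambda>u. (u, 0)) ` S \<union> (\<lambda>v. (0, v)) ` T"
  have left: "(u, 0) \<in> P.span ?G" if "u \<in> U" for u
    using that unfolding S(2)[symmetric]
  proof (induction rule: U.span_induct_alt)
    case base
    show ?case using P.span_zero[of ?G] by (simp add: zero_prod_def)
  next
    case (step c x y)
    have "pscale sU sV c (x, 0) + (y, 0) \<in> P.span ?G"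
      by (intro P.span_add P.span_scale step P.span_base) (use step in auto)
    moreover have "pscale sU sV c (x, 0) + (y, 0) = (sU c x + y, 0)"
      by (simp add: pscale_def)
    ultimately show ?case by simp
  qed
  have right: "(0, v) \<in> P.span ?G" if "v \<in> V" for v
    using that unfolding T(2)[symmetric]
  proof (induction rule: V.span_induct_alt)
    case base
    show ?case using P.span_zero[of ?G] by (simp add: zero_prod_def)
  next
    case (step c x y)
    have "pscale sU sV c (0, x) + (0, y) \<in> P.span ?G"
      by (intro P.span_add P.span_scale step P.span_base) (use step in auto)
    moreover have "pscale sU sV c (0, x) + (0, y) = (0, sV c x + y)"
      by (simp add: pscale_def)
    ultimately show ?case by simp
  qed
  have "p \<in> P.span ?G" if "p \<in> U \<times> V" for p
    using P.span_add[OF left right, of "fst p" "snd p"] that by auto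
  moreover have "P.subspace (U \<times> V)"
    using U.subspace_span[of S] V.subspace_span[of T] unfolding S T
    by (auto simp: P.subspace_def U.subspace_def V.subspace_def pscale_def zero_prod_def)
  moreover have "?G \<subseteq> U \<times> V"
    using U.span_superset[of S] V.span_superset[of T] U.span_zero[of S] V.span_zero[of T]
    unfolding S T by auto
  ultimately have "P.span ?G = U \<times> V" by (meson P.span_minimal subsetI subset_antisym)
  moreover have "finite ?G" using S T by simp
  ultimately show ?thesis unfolding finite_dimensional_on_def by (intro exI[of _ ?G] conjI)
qed


section \<open>The tensor product as a space of functionals\<close>

text \<open>The left factor is a subspace of its type because the dual of \<open>A\<close> is one of the type of all
  functions on \<open>A\<close>.\<close>

locale tensor_product = U: vector_space sU + V: vector_space sV
  for sU :: "'k::field \<Rightarrow> 'u::ab_group_add \<Rightarrow> 'u" and U :: "'u set"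
    and sV :: "'k \<Rightarrow> 'v::ab_group_add \<Rightarrow> 'v" +
  assumes subspace_U: "U.subspace U"
begin

text \<open>Sums of tensors stay folded; they are evaluated at a bilinear form only on request.\<close>

declare plus_fun_apply [simp del] and minus_apply [simp del] and zero_fun_apply [simp del]

abbreviation tens :: "'u \<Rightarrow> 'v \<Rightarrow> ('u, 'v, 'k) tensor" (infix \<open>\<otimes>\<close> 75)
  where "tens \<equiv> pure_tensor sU U sV UNIV"

abbreviation T :: "'v set \<Rightarrow> ('u, 'v, 'k) tensor set"
  where "T \<equiv> tensor_subspace sU U sV UNIV U"

abbreviation bilin :: "('u \<Rightarrow> 'v \<Rightarrow> 'k) \<Rightarrow> bool"
  where "bilin \<equiv> bilinear_on sU U sV UNIV (*)"

sublocale T: vector_space "fscale :: 'k \<Rightarrow> ('u, 'v, 'k) tensor \<Rightarrow> _"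
  by (rule vector_space_fscale)

lemmas U_closed = U.subspace_add[OF subspace_U] U.subspace_scale[OF subspace_U]
  U.subspace_0[OF subspace_U] U.subspace_diff[OF subspace_U]

lemmas tens_bilinear = bilinear_onD[OF bilinear_on_pure_tensor[of sU U sV UNIV]]

lemmas tens_diff = bilinear_on_diff[OF bilinear_on_pure_tensor[of sU U sV UNIV]
    U.vector_space_axioms subspace_U V.vector_space_axioms V.subspace_UNIV]

lemma subspace_T: "T.subspace (T V')"
  unfolding tensor_subspace_def by (rule T.subspace_span)

lemmas T_closed = T.subspace_add[OF subspace_T] T.subspace_scale[OF subspace_T]
  T.subspace_0[OF subspace_T] T.subspace_diff[OF subspace_T]

lemma tens_in_T: "\<lbrakk>u \<in> U; v \<in> V'\<rbrakk> \<Longrightarrow> u \<otimes> v \<in> T V'"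
  unfolding tensor_subspace_def by (rule T.span_base) blast

lemma T_mono: "V' \<subseteq> V'' \<Longrightarrow> T V' \<subseteq> T V''"
  unfolding tensor_subspace_def by (rule T.span_mono) blast

text \<open>A multiple of a pure tensor is again pure, so additivity suffices and the induction needs no
  case for scalars.\<close>

lemma tensor_induct [consumes 2, case_names pure add]:
  assumes "t \<in> T V'" "0 \<in> V'"
    and pure: "\<And>u v. \<lbrakk>u \<in> U; v \<in> V'\<rbrakk> \<Longrightarrow> P (u \<otimes> v)"
    and add: "\<And>s t. \<lbrakk>s \<in> T V'; t \<in> T V'; P s; P t\<rbrakk> \<Longrightarrow> P (s + t)"
  shows "P t"
proof -
  have "t \<in> T V' \<and> P t"
    using assms(1)[unfolded tensor_subspace_def]
  proof (induction rule: T.span_induct_alt)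
    case base
    have "0 = 0 \<otimes> (0 :: 'v)"
      using tens_bilinear(2)[OF U_closed(3) UNIV_I, of 0 "0::'v"]
      by (simp add: fscale_def zero_fun_def)
    with pure[OF U_closed(3) assms(2)] T_closed(3) have "0 \<in> T V' \<and> P 0" by simp
    then show ?case by (simp only: zero_fun_def)
  next
    case (step c x t)
    then obtain u v where "u \<in> U" "v \<in> V'" "x = u \<otimes> v" by blast
    then have "fscale c x = sU c u \<otimes> v" "sU c u \<in> U"
      by (simp_all add: U_closed tens_bilinear)
    with step(2) pure[of "sU c u" v] add \<open>v \<in> V'\<close>
    have "fscale c x + t \<in> T V' \<and> P (fscale c x + t)" by (simp only: tens_in_T T_closed simp_thms)
    then show ?case by (simp only: plus_fun_def)
  qed
  then show ?thesis ..
qed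

text \<open>This is how the Jacobi identity and the cocycle condition are reduced to pure tensors.\<close>

lemma trilinear_eq_0:
  fixes F :: "('u, 'v, 'k) tensor \<Rightarrow> ('u, 'v, 'k) tensor \<Rightarrow> ('u, 'v, 'k) tensor \<Rightarrow> 'w::monoid_add"
  assumes add: "\<And>x x' y z. \<lbrakk>x \<in> T UNIV; x' \<in> T UNIV; y \<in> T UNIV; z \<in> T UNIV\<rbrakk> \<Longrightarrow>
      F (x + x') y z = F x y z + F x' y z"
    "\<And>x y y' z. \<lbrakk>x \<in> T UNIV; y \<in> T UNIV; y' \<in> T UNIV; z \<in> T UNIV\<rbrakk> \<Longrightarrow>
      F x (y + y') z = F x y z + F x y' z"
    "\<And>x y z z'. \<lbrakk>x \<in> T UNIV; y \<in> T UNIV; z \<in> T UNIV; z' \<in> T UNIV\<rbrakk> \<Longrightarrow>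
      F x y (z + z') = F x y z + F x y z'"
    and pure: "\<And>u1 v1 u2 v2 u3 v3. \<lbrakk>u1 \<in> U; u2 \<in> U; u3 \<in> U\<rbrakk> \<Longrightarrow> F (u1 \<otimes> v1) (u2 \<otimes> v2) (u3 \<otimes> v3) = 0"
    and x: "x \<in> T UNIV" and y: "y \<in> T UNIV" and z: "z \<in> T UNIV"
  shows "F x y z = 0"
  using x UNIV_I
proof (induction rule: tensor_induct)
  case (pure u1 v1)
  show ?case
    using y UNIV_I
  proof (induction rule: tensor_induct)
    case (pure u2 v2)
    show ?case
      using z UNIV_I
      by (induction rule: tensor_induct)
        (simp_all add: assms(4) add(3) tens_in_T pure \<open>u1 \<in> U\<close>)
  qed (simp add: add(2) tens_in_T pure z)
qed (simp add: add(1) y z)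

text \<open>A tensor is linear in the bilinear form to which it is applied, and it sees that form only on \<open>U\<close>.
  The second point matters: the products used below are linear only on \<open>U\<close>, so the hypothesis
  cannot ask for an equation between functions on the whole type.\<close>

lemma tensor_linear:
  assumes t: "t \<in> T UNIV" and \<beta>: "bilin \<beta>" "bilin \<gamma>" "bilin \<delta>"
    and eq: "\<And>u v. u \<in> U \<Longrightarrow> \<beta> u v = c * \<gamma> u v + \<delta> u v"
  shows "t \<beta> = c * t \<gamma> + t \<delta>"
  using t UNIV_I
  by (induction rule: tensor_induct) (simp_all add: pure_tensor_def \<beta> eq algebra_simps plus_fun_apply)

definition quadrilinear :: "('u \<Rightarrow> 'v \<Rightarrow> 'u \<Rightarrow> 'v \<Rightarrow> 'k) \<Rightarrow> bool"
  where "quadrilinear h \<longleftrightarrow>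
    (\<forall>u\<in>U. \<forall>v. bilin (h u v) \<and> bilin (\<lambda>u' v'. h u' v' u v))"

lemma tensor_ext_tens:
  assumes "quadrilinear h" "u1 \<in> U" "u2 \<in> U"
  shows "tensor_ext h (u1 \<otimes> v1) (u2 \<otimes> v2) = h u1 v1 u2 v2"
  by (rule tensor_ext_pure)
    (use assms in \<open>auto simp: quadrilinear_def subspace_U U.vector_space_axioms V.vector_space_axioms\<close>)

text \<open>Linearity in the left argument holds by definition. In the right argument it follows from
  \<open>tensor_linear\<close>, applied to the right tensor (\<open>inner\<close>) and then to the left one.\<close>

lemma bilinear_tensor_ext:
  assumes h: "quadrilinear h"
  shows "bilinear_on fscale (T UNIV) fscale (T UNIV) (*) (tensor_ext h)"
proof -
  have hb: "bilin (h u v)" "bilin (\<lambda>u' v'. h u' v' u v)" if "u \<in> U" for u v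
    using h that by (auto simp: quadrilinear_def)
  have 0: "bilin (\<lambda>_ _. 0)" by (simp add: bilinear_on_def)
  have inner: "bilin (\<lambda>u v. t (h u v))" if t: "t \<in> T UNIV" for t
    unfolding bilinear_on_def
  proof (intro conjI ballI allI)
    show "t (h (x + y) v) = t (h x v) + t (h y v)" if "x \<in> U" "y \<in> U" for x y v
      using tensor_linear[OF t, of "h (x + y) v" "h x v" "h y v" 1] that
      by (simp add: hb U_closed bilinear_onD(1)[OF hb(2)])
    show "t (h x (v + w)) = t (h x v) + t (h x w)" if "x \<in> U" for x v w
      using tensor_linear[OF t, of "h x (v + w)" "h x v" "h x w" 1] that
      by (simp add: hb U_closed bilinear_onD(3)[OF hb(2)])
    have t0: "t (\<lambda>_ _. 0) = 0"
      using tensor_linear[OF t 0 0 0, of "- 1"] by simp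
    show "t (h (sU c x) v) = c * t (h x v)" if "x \<in> U" for c x v
      using tensor_linear[OF t, of "h (sU c x) v" "h x v" "\<lambda>_ _. 0" c] that
      by (simp add: hb U_closed bilinear_onD(2)[OF hb(2)] t0 0)
    show "t (h x (sV c v)) = c * t (h x v)" if "x \<in> U" for c x v
      using tensor_linear[OF t, of "h x (sV c v)" "h x v" "\<lambda>_ _. 0" c] that
      by (simp add: hb U_closed bilinear_onD(4)[OF hb(2)] t0 0)
  qed
  show ?thesis
    unfolding bilinear_on_def
  proof (intro conjI ballI allI)
    fix s t assume s: "s \<in> T UNIV" and t: "t \<in> T UNIV"
    show "tensor_ext h s (t + t') = tensor_ext h s t + tensor_ext h s t'" if t': "t' \<in> T UNIV" for t'
      using tensor_linear[OF s inner inner inner, of "t + t'" t t' 1] t t'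
      by (simp add: T_closed tensor_ext_def plus_fun_apply)
    have s0: "s (\<lambda>_ _. 0) = 0"
      using tensor_linear[OF s 0 0 0, of "- 1"] by simp
    show "tensor_ext h s (fscale c t) = c * tensor_ext h s t" for c
      using tensor_linear[OF s inner inner 0, OF T_closed(2), of t t c c] t
      by (simp add: tensor_ext_def fscale_def s0)
  qed (simp_all add: tensor_ext_def fscale_def plus_fun_apply)
qed

lemma T_eq_span:
  assumes "U.span S = U" "V.span R = V'"
  shows "T V' = T.span ((\<lambda>(u, v). u \<otimes> v) ` (S \<times> R))"
proof -
  let ?G = "(\<lambda>(u, v). u \<otimes> v) ` (S \<times> R)"
  have SU: "S \<subseteq> U" and RV: "R \<subseteq> V'"
    using assms U.span_superset V.span_superset by blast+
  have left: "u \<otimes> r \<in> T.span ?G" if "u \<in> U" "r \<in> R" for u r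
  proof -
    have "u \<in> U \<and> u \<otimes> r \<in> T.span ?G"
      using that(1)[folded assms(1)]
    proof (induction rule: U.span_induct_alt)
      case base
      have "0 \<otimes> r = fscale 0 (0 \<otimes> r)"
        using tens_bilinear(2)[OF U_closed(3) UNIV_I, of 0 r] by simp
      then have "0 \<otimes> r \<in> T.span ?G"
        by (simp only: T.scale_zero_left T.span_zero)
      then show ?case by (simp add: U_closed)
    next
      case (step c x y)
      then have "x \<in> U" "y \<in> U" using SU by auto
      moreover have "x \<otimes> r \<in> T.span ?G" by (rule T.span_base) (use step that in auto)
      then have "fscale c (x \<otimes> r) + y \<otimes> r \<in> T.span ?G"
        using step(2) by (intro T.span_add T.span_scale) simp_all
      ultimately show ?case by (simp add: tens_bilinear U_closed)
    qed
    then show ?thesis ..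
  qed
  have right: "u \<otimes> v \<in> T.span ?G" if "u \<in> U" "v \<in> V'" for u v
    using that(2)[folded assms(2)]
  proof (induction rule: V.span_induct_alt)
    case base
    have "u \<otimes> 0 = fscale 0 (u \<otimes> 0)"
      using tens_bilinear(4)[OF that(1) UNIV_I, of 0 0] by simp
    then show ?case by (simp only: T.scale_zero_left T.span_zero)
  next
    case (step c x y)
    have "fscale c (u \<otimes> x) + u \<otimes> y \<in> T.span ?G"
      by (intro T.span_add T.span_scale left that(1) step)
    then show ?case by (simp add: tens_bilinear that(1))
  qed
  have "{u \<otimes> v | u v. u \<in> U \<and> v \<in> V'} \<subseteq> T.span ?G" using right by blast
  moreover have "?G \<subseteq> T V'" using SU RV by (auto intro: tens_in_T)
  ultimately show ?thesis
    unfolding tensor_subspace_def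
    by (intro subset_antisym T.span_minimal T.subspace_span) (simp_all add: tensor_subspace_def)
qed

lemma finite_dimensional_T:
  assumes "finite_dimensional_on sU U" "finite_dimensional_on sV V'"
  shows "finite_dimensional_on fscale (T V')"
proof -
  from assms obtain S R where "finite S" "U.span S = U" "finite R" "V.span R = V'"
    by (auto simp: finite_dimensional_on_def)
  then show ?thesis
    unfolding finite_dimensional_on_def
    by (intro exI[of _ "(\<lambda>(u, v). u \<otimes> v) ` (S \<times> R)"]) (simp add: T_eq_span)
qed

text \<open>The projection \<open>Q i\<close> onto \<open>U \<otimes> V\<^sub>i\<close> is \<open>id \<otimes> P i\<close>, obtained from the universal property.\<close>

lemma graded_space_tensor:
  assumes fd: "finite_dimensional_on sU U" and graded: "graded_space sV UNIV Vs"
  shows "graded_space fscale (T UNIV) (\<lambda>i. T (Vs i))"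
proof -
  obtain P where P: "\<And>i. Vector_Spaces.linear sV sV (P i)" "\<And>i x. P i x \<in> Vs i"
      "\<And>i x. x \<in> Vs i \<Longrightarrow> P i x = x" "\<And>i j x. \<lbrakk>x \<in> Vs j; i \<noteq> j\<rbrakk> \<Longrightarrow> P i x = 0"
      "\<And>x. x \<in> V.span (\<Union>i. Vs i)"
    using graded_space_projections[OF V.vector_space_axioms graded] by blast
  interpret P: Vector_Spaces.linear sV sV "P i" for i by (rule P)
  have Vs: "V.subspace (Vs i)" "finite_dimensional_on sV (Vs i)" for i
    using graded by (auto simp: graded_space_def)
  have "bilinear_on sU U sV UNIV fscale (\<lambda>u v. u \<otimes> P i v)" for i
    by (simp add: bilinear_on_def tens_bilinear P.add P.scale)
  from tensor_universal[OF T.vector_space_axioms this]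
  obtain Q where Q: "\<And>i. Vector_Spaces.linear fscale fscale (Q i)"
      "\<And>i u v. u \<in> U \<Longrightarrow> Q i (u \<otimes> v) = u \<otimes> P i v"
    by (metis UNIV_I)
  interpret Q: Vector_Spaces.linear fscale fscale "Q i" for i by (rule Q)
  have T0: "u \<otimes> 0 = 0" if "u \<in> U" for u
    using tens_bilinear(4)[OF that UNIV_I, of 0 0] by simp
  show ?thesis
  proof (rule graded_space_of_projections[OF T.vector_space_axioms, of _ _ Q])
    fix i j x
    show "T.subspace (T (Vs i))" by (rule subspace_T)
    show "T (Vs i) \<subseteq> T UNIV" by (rule T_mono) simp
    show "finite_dimensional_on fscale (T (Vs i))" by (rule finite_dimensional_T[OF fd Vs(2)])
    show "Vector_Spaces.linear fscale fscale (Q i)" by (rule Q)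
    show "Q i x = x" if "x \<in> T (Vs i)"
      using that V.subspace_0[OF Vs(1)]
      by (induction rule: tensor_induct) (simp_all add: Q P Q.add)
    show "Q i x = 0" if "x \<in> T (Vs j)" "i \<noteq> j"
      using that(1) V.subspace_0[OF Vs(1)]
      by (induction rule: tensor_induct) (simp_all only: Q P(4)[OF _ that(2)] Q.add T0 add_0)
  next
    have "u \<otimes> v \<in> T.span (\<Union>i. T (Vs i))" if u: "u \<in> U" for u v
      using P(5)[of v]
    proof (induction rule: V.span_induct_alt)
      case base
      show ?case by (simp only: T0[OF u] T.span_zero)
    next
      case (step c x y)
      have "u \<otimes> x \<in> (\<Union>i. T (Vs i))" using step(1) u by (auto intro: tens_in_T)
      then have "fscale c (u \<otimes> x) + u \<otimes> y \<in> T.span (\<Union>i. T (Vs i))"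
        by (intro T.span_add T.span_scale step) (rule T.span_base)
      then show ?case by (simp add: tens_bilinear u)
    qed
    then show "T UNIV \<subseteq> T.span (\<Union>i. T (Vs i))"
      unfolding tensor_subspace_def[of _ _ _ _ _ UNIV]
      by (intro T.span_minimal T.subspace_span) blast
  qed
qed

lemma quadrilinear_prod:
  assumes "bilinear_on sU U sU U (*) p" "bilinear_on sV UNIV sV UNIV (*) q"
  shows "quadrilinear (\<lambda>u1 v1 u2 v2. p u1 u2 * q v1 v2)"
  by (simp add: quadrilinear_def bilinear_on_def[of _ U _ UNIV] bilinear_onD[OF assms(1)]
      bilinear_onD[OF assms(2)] algebra_simps)

lemma tensor_expand_basis:
  assumes S: "U.span S = U" "finite S" "U.independent S" and x: "x \<in> T UNIV"
  obtains v where "x = (\<Sum>b\<in>S. b \<otimes> v b)"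
proof -
  have SU: "b \<in> U" if "b \<in> S" for b using S U.span_superset that by blast
  have "\<exists>v. x = (\<Sum>b\<in>S. b \<otimes> v b)"
    using x UNIV_I
  proof (induction rule: tensor_induct)
    case (pure u w)
    let ?r = "U.representation S u"
    have u: "u = (\<Sum>b\<in>S. sU (?r b) b)"
      using U.sum_representation_eq[OF S(3) _ S(2) subset_refl] pure S(1) by simp
    have "u \<otimes> w = (\<Sum>b\<in>S. sU (?r b) b \<otimes> w)"
      by (subst u, rule bilinear_on_left_sum[OF bilinear_on_pure_tensor U.vector_space_axioms subspace_U])
        (simp_all add: SU U_closed)
    also have "\<dots> = (\<Sum>b\<in>S. b \<otimes> sV (?r b) w)"
      by (rule sum.cong) (simp_all add: SU tens_bilinear)
    finally show ?case by (rule exI[of _ "\<lambda>b. sV (?r b) w"])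
  next
    case (add s t)
    then obtain v v' where "s = (\<Sum>b\<in>S. b \<otimes> v b)" "t = (\<Sum>b\<in>S. b \<otimes> v' b)" by blast
    then have "s + t = (\<Sum>b\<in>S. b \<otimes> (v b + v' b))"
      by (simp add: SU tens_bilinear sum.distrib)
    then show ?case by (rule exI[of _ "\<lambda>b. v b + v' b"])
  qed
  with that show thesis by blast
qed

text \<open>Write \<open>x = \<Sum>\<^sub>b b \<otimes> v b\<close> over a basis of \<open>U\<close>. Pairing \<open>x\<close> with \<open>u \<otimes> w\<close> gives \<open>p z u\<close> with
  \<open>z = \<Sum>\<^sub>b q(v b, w) b\<close>. As \<open>u\<close> is arbitrary, \<open>z = 0\<close>; independence gives \<open>q(v b, w) = 0\<close> for all
  \<open>w\<close>, hence \<open>v b = 0\<close>.\<close>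

lemma tensor_form_nondegenerate:
  assumes fd: "finite_dimensional_on sU U"
    and p: "bilinear_on sU U sU U (*) p" and q: "bilinear_on sV UNIV sV UNIV (*) q"
    and p_nd: "nondegenerate_on U p" and q_nd: "nondegenerate_on UNIV q"
    and x: "x \<in> T UNIV" and orth: "\<And>y. y \<in> T UNIV \<Longrightarrow> tensor_form p q x y = 0"
  shows "x = 0"
proof -
  obtain R where R: "finite R" "U.span R = U" using fd by (auto simp: finite_dimensional_on_def)
  obtain S where S: "S \<subseteq> R" "U.independent S" "R \<subseteq> U.span S"
    using U.maximal_independent_subset[of R] by blast
  have finS: "finite S" using S R finite_subset by blast
  have "S \<subseteq> U" using S(1) R(2) U.span_superset by blast
  then have spanS: "U.span S = U"
    using R(2) S(3) by (metis U.span_minimal U.subspace_span subset_antisym subspace_U)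
  obtain v where v: "x = (\<Sum>b\<in>S. b \<otimes> v b)"
    by (rule tensor_expand_basis[OF spanS finS S(2) x])
  have h: "quadrilinear (\<lambda>u1 v1 u2 v2. p u1 u2 * q v1 v2)" by (rule quadrilinear_prod[OF p q])
  have "v b = 0" if b: "b \<in> S" for b
  proof -
    have "q (v b) w = 0" for w
    proof -
      let ?z = "\<Sum>b\<in>S. sU (q (v b) w) b"
      have z: "?z \<in> U" using \<open>S \<subseteq> U\<close> by (auto intro!: U.subspace_sum[OF subspace_U] U_closed)
      have "p ?z u = 0" if u: "u \<in> U" for u
      proof -
        have "p ?z u = (\<Sum>b\<in>S. p (sU (q (v b) w) b) u)"
          by (rule bilinear_on_left_sum[OF p U.vector_space_axioms subspace_U _ u])
            (use \<open>S \<subseteq> U\<close> in \<open>auto intro: U_closed\<close>)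
        also have "\<dots> = (\<Sum>b\<in>S. tensor_form p q (b \<otimes> v b) (u \<otimes> w))"
          unfolding tensor_form_def
          by (rule sum.cong) (use \<open>S \<subseteq> U\<close> u in \<open>auto simp: tensor_ext_tens[OF h] bilinear_onD[OF p]\<close>)
        also have "\<dots> = tensor_form p q x (u \<otimes> w)"
          unfolding v tensor_form_def
          by (rule bilinear_on_left_sum[symmetric,
                OF bilinear_tensor_ext[OF h] T.vector_space_axioms subspace_T])
            (use \<open>S \<subseteq> U\<close> u in \<open>auto intro: tens_in_T\<close>)
        also have "\<dots> = 0" using orth u by (simp add: tens_in_T)
        finally show ?thesis .
      qed
      then have "?z = 0" using p_nd z by (auto simp: nondegenerate_on_def)
      then show ?thesis using U.independentD[OF S(2) finS subset_refl _ b] by fast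
    qed
    then show ?thesis using q_nd by (auto simp: nondegenerate_on_def)
  qed
  moreover have "b \<otimes> 0 = 0" if "b \<in> S" for b
    using tens_bilinear(4)[OF _ UNIV_I, of b 0 0] that \<open>S \<subseteq> U\<close> by auto
  ultimately show ?thesis unfolding v by (metis (no_types, lifting) sum.neutral)
qed

end


section \<open>The induced Lie algebra\<close>

locale novikov_tensor = tensor_product sU U sV
  for sU :: "'k::field \<Rightarrow> 'u::ab_group_add \<Rightarrow> 'u" and U :: "'u set"
    and sV :: "'k \<Rightarrow> 'v::ab_group_add \<Rightarrow> 'v" +
  fixes circ :: "'u \<Rightarrow> 'u \<Rightarrow> 'u" (infixl \<open>\<odot>\<close> 76)
    and dia :: "'v \<Rightarrow> 'v \<Rightarrow> 'v" (infixl \<open>\<diamondop>\<close> 76)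
  assumes circ_closed: "\<lbrakk>x \<in> U; y \<in> U\<rbrakk> \<Longrightarrow> x \<odot> y \<in> U"
    and bilinear_circ: "bilinear_on sU U sU U sU (\<odot>)"
    and circ_left_symmetric: "\<lbrakk>x \<in> U; y \<in> U; z \<in> U\<rbrakk> \<Longrightarrow>
      (x \<odot> y) \<odot> z - x \<odot> (y \<odot> z) = (y \<odot> x) \<odot> z - y \<odot> (x \<odot> z)"
    and circ_right_commutative: "\<lbrakk>x \<in> U; y \<in> U; z \<in> U\<rbrakk> \<Longrightarrow> (x \<odot> y) \<odot> z = (x \<odot> z) \<odot> y"
    and bilinear_dia: "bilinear_on sV UNIV sV UNIV sV (\<diamondop>)"
    and dia_right_symmetric: "(a \<diamondop> b) \<diamondop> c - a \<diamondop> (b \<diamondop> c) = (a \<diamondop> c) \<diamondop> b - a \<diamondop> (c \<diamondop> b)"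
    and dia_left_commutative: "a \<diamondop> (b \<diamondop> c) = b \<diamondop> (a \<diamondop> c)"
begin

abbreviation br :: "('u, 'v, 'k) tensor \<Rightarrow> ('u, 'v, 'k) tensor \<Rightarrow> ('u, 'v, 'k) tensor"
  where "br \<equiv> induced_bracket sU U sV UNIV (\<odot>) (\<diamondop>)"

lemma quadrilinear_bracket:
  "quadrilinear (\<lambda>u1 v1 u2 v2. (u1 \<odot> u2 \<otimes> v1 \<diamondop> v2 - u2 \<odot> u1 \<otimes> v2 \<diamondop> v1) \<beta>)"
  by (simp add: quadrilinear_def bilinear_on_def[of _ U _ UNIV] bilinear_onD[OF bilinear_circ]
      bilinear_onD[OF bilinear_dia] tens_bilinear circ_closed U_closed fscale_def plus_fun_apply
      minus_apply algebra_simps)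

lemma bracket_tens:
  assumes "u1 \<in> U" "u2 \<in> U"
  shows "br (u1 \<otimes> v1) (u2 \<otimes> v2) = u1 \<odot> u2 \<otimes> v1 \<diamondop> v2 - u2 \<odot> u1 \<otimes> v2 \<diamondop> v1"
  unfolding induced_bracket_def
  by (rule ext) (simp only: tensor_ext_tens[OF quadrilinear_bracket] assms)

lemma bilinear_bracket: "bilinear_on fscale (T UNIV) fscale (T UNIV) fscale br"
  using bilinear_onD[OF bilinear_tensor_ext[OF quadrilinear_bracket]]
  by (simp add: bilinear_on_def induced_bracket_def fscale_def fun_eq_iff plus_fun_apply)

lemmas bracket_bilinear = bilinear_onD[OF bilinear_bracket]

text \<open>Both orders of the product occur in the bracket, so both must land in \<open>V3\<close>.\<close>

lemma bracket_graded:
  assumes V12: "0 \<in> V1" "0 \<in> V2" and V3: "\<And>v w. \<lbrakk>v \<in> V1; w \<in> V2\<rbrakk> \<Longrightarrow> v \<diamondop> w \<in> V3 \<and> w \<diamondop> v \<in> V3"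
    and x: "x \<in> T V1" and y: "y \<in> T V2"
  shows "br x y \<in> T V3"
proof -
  have sub: "t \<in> T UNIV" if "t \<in> T V'" for t V' using that T_mono[of V' UNIV] by auto
  show ?thesis
    using x V12(1)
  proof (induction rule: tensor_induct)
    case (pure u v)
    show ?case
      using y V12(2)
      by (induction rule: tensor_induct)
        (simp_all add: bracket_tens bracket_bilinear tens_in_T T_closed circ_closed V3 pure sub)
  qed (simp add: bracket_bilinear T_closed sub[OF y] sub)
qed

lemma bracket_closed: "\<lbrakk>x \<in> T UNIV; y \<in> T UNIV\<rbrakk> \<Longrightarrow> br x y \<in> T UNIV"
  by (rule bracket_graded[of UNIV UNIV]) auto

lemma bracket_self:
  assumes "x \<in> T UNIV"
  shows "br x x = 0"
proof -
  \<comment> \<open>The square of a sum produces mixed brackets, so antisymmetry comes first.\<close>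
  have anti: "br x y + br y x = 0" if "x \<in> T UNIV" "y \<in> T UNIV" for x y
    using that(1) UNIV_I
  proof (induction rule: tensor_induct)
    case (pure u v)
    show ?case
      using that(2) UNIV_I
    proof (induction rule: tensor_induct)
      case (add s t)
      have "br (u \<otimes> v) (s + t) + br (s + t) (u \<otimes> v)
          = (br (u \<otimes> v) s + br s (u \<otimes> v)) + (br (u \<otimes> v) t + br t (u \<otimes> v))"
        using pure add(1,2) by (simp add: bracket_bilinear tens_in_T add_ac)
      then show ?case by (simp add: add)
    qed (simp add: bracket_tens pure)
  next
    case (add s t)
    have "br (s + t) y + br y (s + t) = (br s y + br y s) + (br t y + br y t)"
      using that(2) add(1,2) by (simp add: bracket_bilinear add_ac)
    then show ?case by (simp add: add)
  qed
  show ?thesis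
    using assms UNIV_I
  proof (induction rule: tensor_induct)
    case (add s t)
    have "br (s + t) (s + t) = br s s + br t t + (br s t + br t s)"
      using add(1,2) by (simp add: bracket_bilinear T_closed add_ac)
    then show ?case using add anti by simp
  qed (simp add: bracket_tens)
qed

text \<open>By right commutativity a product \<open>(u\<^sub>i \<odot> u\<^sub>j) \<odot> u\<^sub>k\<close> depends only on \<open>i\<close>, which leaves three values
  \<open>X\<^sub>i\<close>; by left commutativity \<open>v\<^sub>i \<diamondop> (v\<^sub>j \<diamondop> v\<^sub>k)\<close> depends only on \<open>k\<close>, which leaves three values \<open>Y\<^sub>k\<close>.
  The symmetry of the associators then says
  \<open>u\<^sub>i \<odot> (u\<^sub>j \<odot> u\<^sub>k) - u\<^sub>j \<odot> (u\<^sub>i \<odot> u\<^sub>k) = X\<^sub>i - X\<^sub>j\<close> and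
  \<open>(v\<^sub>i \<diamondop> v\<^sub>j) \<diamondop> v\<^sub>k - (v\<^sub>i \<diamondop> v\<^sub>k) \<diamondop> v\<^sub>j = Y\<^sub>k - Y\<^sub>j\<close>. The terms of the Jacobi sum pair up into exactly these
  differences, and what remains is a combination of the \<open>X\<^sub>i \<otimes> Y\<^sub>j\<close> that cancels.\<close>

lemma jacobi_tens:
  assumes u: "u1 \<in> U" "u2 \<in> U" "u3 \<in> U"
  shows "br (u1 \<otimes> v1) (br (u2 \<otimes> v2) (u3 \<otimes> v3)) + br (u2 \<otimes> v2) (br (u3 \<otimes> v3) (u1 \<otimes> v1))
    + br (u3 \<otimes> v3) (br (u1 \<otimes> v1) (u2 \<otimes> v2)) = 0"
proof -
  note br_diff = bilinear_on_diff[OF bilinear_bracket T.vector_space_axioms subspace_T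
      T.vector_space_axioms subspace_T]
  have expand: "br (a \<otimes> x) (br (b \<otimes> y) (c \<otimes> z))
      = a \<odot> (b \<odot> c) \<otimes> x \<diamondop> (y \<diamondop> z) - (b \<odot> c) \<odot> a \<otimes> (y \<diamondop> z) \<diamondop> x
        - (a \<odot> (c \<odot> b) \<otimes> x \<diamondop> (z \<diamondop> y) - (c \<odot> b) \<odot> a \<otimes> (z \<diamondop> y) \<diamondop> x)"
    if "a \<in> U" "b \<in> U" "c \<in> U" for a b c x y z
    using that by (simp add: bracket_tens br_diff tens_in_T circ_closed)
  define X1 where "X1 = (u1 \<odot> u2) \<odot> u3"
  define X2 where "X2 = (u2 \<odot> u3) \<odot> u1"
  define X3 where "X3 = (u3 \<odot> u1) \<odot> u2"
  define Y1 where "Y1 = v2 \<diamondop> (v3 \<diamondop> v1)"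
  define Y2 where "Y2 = v3 \<diamondop> (v1 \<diamondop> v2)"
  define Y3 where "Y3 = v1 \<diamondop> (v2 \<diamondop> v3)"
  have X: "X1 \<in> U" "X2 \<in> U" "X3 \<in> U" using u by (simp_all add: X1_def X2_def X3_def circ_closed)
  have nested_left: "(u1 \<odot> u2) \<odot> u3 = X1" "(u1 \<odot> u3) \<odot> u2 = X1" "(u2 \<odot> u3) \<odot> u1 = X2"
      "(u2 \<odot> u1) \<odot> u3 = X2" "(u3 \<odot> u1) \<odot> u2 = X3" "(u3 \<odot> u2) \<odot> u1 = X3"
    using u by (simp_all add: X1_def X2_def X3_def circ_right_commutative)
  have nested_right: "v2 \<diamondop> (v3 \<diamondop> v1) = Y1" "v3 \<diamondop> (v2 \<diamondop> v1) = Y1" "v3 \<diamondop> (v1 \<diamondop> v2) = Y2"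
      "v1 \<diamondop> (v3 \<diamondop> v2) = Y2" "v1 \<diamondop> (v2 \<diamondop> v3) = Y3" "v2 \<diamondop> (v1 \<diamondop> v3) = Y3"
    by (simp_all add: Y1_def Y2_def Y3_def dia_left_commutative)
  have ass_u: "u1 \<odot> (u2 \<odot> u3) = X1 - X2 + u2 \<odot> (u1 \<odot> u3)"
      "u2 \<odot> (u3 \<odot> u1) = X2 - X3 + u3 \<odot> (u2 \<odot> u1)"
      "u3 \<odot> (u1 \<odot> u2) = X3 - X1 + u1 \<odot> (u3 \<odot> u2)"
    using circ_left_symmetric[of u1 u2 u3] circ_left_symmetric[of u2 u3 u1]
      circ_left_symmetric[of u3 u1 u2] u by (simp_all add: nested_left algebra_simps)
  have ass_v: "(v1 \<diamondop> v2) \<diamondop> v3 = Y3 - Y2 + (v1 \<diamondop> v3) \<diamondop> v2"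
      "(v2 \<diamondop> v3) \<diamondop> v1 = Y1 - Y3 + (v2 \<diamondop> v1) \<diamondop> v3"
      "(v3 \<diamondop> v1) \<diamondop> v2 = Y2 - Y1 + (v3 \<diamondop> v2) \<diamondop> v1"
    using dia_right_symmetric[of v1 v2 v3] dia_right_symmetric[of v2 v3 v1]
      dia_right_symmetric[of v3 v1 v2] by (simp_all add: nested_right algebra_simps)
  show ?thesis
    using u X
    by (simp add: expand nested_left nested_right ass_u ass_v tens_bilinear tens_diff circ_closed
        U_closed)
qed

lemma jacobi:
  assumes "x \<in> T UNIV" "y \<in> T UNIV" "z \<in> T UNIV"
  shows "br x (br y z) + br y (br z x) + br z (br x y) = 0"
  by (rule trilinear_eq_0[where F = "\<lambda>x y z. br x (br y z) + br y (br z x) + br z (br x y)"])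
    (simp_all add: assms jacobi_tens bracket_bilinear bracket_closed T_closed)

end


section \<open>Quasi-Frobenius Lie algebras from Novikov algebras with a cocycle\<close>

lemma quasi_frobenius_tensor_product:
  fixes sU :: "'k::field_char_0 \<Rightarrow> 'u::ab_group_add \<Rightarrow> 'u"
  assumes "novikov_tensor sU U sB circ dia"
    and B: "quadratic_graded_right_novikov_algebra sB Bs dia formB"
    and fd: "finite_dimensional_on sU U"
    and \<omega>: "bilinear_on sU U sU U (*) \<omega>" "nondegenerate_on U \<omega>"
    and skew: "\<And>x y. \<lbrakk>x \<in> U; y \<in> U\<rbrakk> \<Longrightarrow> \<omega> x y = - \<omega> y x"
    and cocycle: "\<And>x y z. \<lbrakk>x \<in> U; y \<in> U; z \<in> U\<rbrakk> \<Longrightarrow>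
      \<omega> (circ x y) z - \<omega> (circ x z + circ z x) y + \<omega> (circ z y) x = 0"
  shows "quasi_frobenius_graded_lie_algebra fscale (tensor_space sU U sB UNIV)
    (\<lambda>i. tensor_subspace sU U sB UNIV U (Bs i)) (induced_bracket sU U sB UNIV circ dia)
    (tensor_form \<omega> formB)"
proof -
  interpret novikov_tensor sU U sB circ dia by fact
  interpret B: quadratic_graded_right_novikov_algebra sB Bs dia formB by fact
  let ?F = "tensor_form \<omega> formB"
  have quad: "quadrilinear (\<lambda>u1 v1 u2 v2. \<omega> u1 u2 * formB v1 v2)"
    by (rule quadrilinear_prod[OF \<omega>(1) B.bilinear_form])
  note F_tens = tensor_ext_tens[OF quad, folded tensor_form_def]
  note F_bilinear = bilinear_tensor_ext[OF quad, folded tensor_form_def]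
  note F_simps = bilinear_onD[OF F_bilinear]
  note F_diff = bilinear_on_diff[OF F_bilinear T.vector_space_axioms subspace_T
      T.vector_space_axioms subspace_T]
  have Bs: "0 \<in> Bs i" "V.subspace (Bs i)" for i
    using B.graded_space V.subspace_0 by (auto simp: graded_space_def)
  have sub: "t \<in> T UNIV" if "t \<in> T V'" for t V' using that T_mono[of V' UNIV] by auto
  have F_skew: "?F x y = - ?F y x" if "x \<in> T UNIV" "y \<in> T UNIV" for x y
    using that(1) UNIV_I
  proof (induction rule: tensor_induct)
    case (pure u v)
    show ?case
      using that(2) UNIV_I
    proof (induction rule: tensor_induct)
      case (pure u' v')
      then show ?case
        using skew[of u u'] \<open>u \<in> U\<close> B.symmetric_form[of v v'] by (simp add: F_tens)
    qed (simp add: F_simps tens_in_T pure)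
  qed (simp add: F_simps that(2))
  have F_nd: "x = 0" if "x \<in> T UNIV" "\<And>y. y \<in> T UNIV \<Longrightarrow> ?F x y = 0" for x
    by (rule tensor_form_nondegenerate[OF fd \<omega>(1) B.bilinear_form \<omega>(2) B.nondegenerate_form that])
  have closed: "?F (br a b) c + ?F (br c a) b + ?F (br b c) a = 0"
    if "a \<in> T UNIV" "b \<in> T UNIV" "c \<in> T UNIV" for a b c
  proof (rule trilinear_eq_0[where F = "\<lambda>a b c. ?F (br a b) c + ?F (br c a) b + ?F (br b c) a"])
    fix u1 u2 u3 v1 v2 v3 assume u: "u1 \<in> U" "u2 \<in> U" "u3 \<in> U"
    define t where "t x y z = formB (dia x y) z" for x y z
    have "t x y z = t x z y" for x y z
      unfolding t_def B.invariant_form by (simp add: add.commute)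
    then have t_comm: "t v1 v3 v2 = t v1 v2 v3" "t v2 v3 v1 = t v2 v1 v3" "t v3 v2 v1 = t v3 v1 v2"
      by blast+
    \<comment> \<open>The cyclic sum of \<open>t\<close> vanishes; this eliminates the third of its three values.\<close>
    have t3: "t v3 v1 v2 = - t v1 v2 v3 - t v2 v1 v3"
    proof -
      have "t v1 v2 v3 = - (t v2 v3 v1 + t v3 v2 v1)"
        unfolding t_def using B.invariant_form[of v1 v2 v3] B.symmetric_form[of v1]
        by (simp add: bilinear_onD[OF B.bilinear_form])
      then show ?thesis by (simp add: t_comm)
    qed
    have w: "\<omega> (circ x y) z = \<omega> (circ x z) y + \<omega> (circ z x) y - \<omega> (circ z y) x"
      if "x \<in> U" "y \<in> U" "z \<in> U" for x y z
      using cocycle[OF that] that by (simp add: bilinear_onD[OF \<omega>(1)] circ_closed algebra_simps)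
    have "?F (br (tens u1 v1) (tens u2 v2)) (tens u3 v3) + ?F (br (tens u3 v3) (tens u1 v1)) (tens u2 v2)
        + ?F (br (tens u2 v2) (tens u3 v3)) (tens u1 v1)
      = (\<omega> (circ u1 u2) u3 - \<omega> (circ u1 u3) u2 - \<omega> (circ u3 u1) u2 + \<omega> (circ u3 u2) u1) * t v1 v2 v3
        - (\<omega> (circ u2 u1) u3 - \<omega> (circ u2 u3) u1 - \<omega> (circ u3 u2) u1 + \<omega> (circ u3 u1) u2) * t v2 v1 v3"
      using u by (simp add: bracket_tens F_diff F_tens tens_in_T circ_closed t_def[symmetric]
          t_comm t3 algebra_simps)
    \<comment> \<open>Both coefficients are cocycle relations; the second is the first with 1 and 2 exchanged.\<close>
    also have "\<dots> = 0" using w[of u1 u2 u3] w[of u2 u1 u3] u by simp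
    finally show "?F (br (tens u1 v1) (tens u2 v2)) (tens u3 v3)
      + ?F (br (tens u3 v3) (tens u1 v1)) (tens u2 v2) + ?F (br (tens u2 v2) (tens u3 v3)) (tens u1 v1) = 0" .
  qed (simp_all add: that F_simps bracket_bilinear bracket_closed T_closed)
  obtain m where m: "\<And>i j x y. \<lbrakk>i + j + m \<noteq> 0; x \<in> Bs i; y \<in> Bs j\<rbrakk> \<Longrightarrow> formB x y = 0"
    using B.graded_form unfolding graded_form_def by blast
  have F_graded: "?F x y = 0" if ij: "i + j + m \<noteq> 0" and x: "x \<in> T (Bs i)" and y: "y \<in> T (Bs j)"
    for i j x y
    using x Bs(1)
  proof (induction rule: tensor_induct)
    case (pure u v)
    show ?case
      using y Bs(1)
      by (induction rule: tensor_induct)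
        (simp_all add: F_tens F_simps tens_in_T pure sub m[OF ij])
  qed (simp add: F_simps sub[OF y] sub)
  show ?thesis
  proof unfold_locales
    show "graded_mult (\<lambda>i. T (Bs i)) br"
      unfolding graded_mult_def
    proof (intro allI ballI)
      fix i j x y assume xy: "x \<in> T (Bs i)" "y \<in> T (Bs j)"
      have dia: "dia v w \<in> Bs (k + l)" if "v \<in> Bs k" "w \<in> Bs l" for v w k l
        using B.graded_dia that by (simp add: graded_mult_def)
      have dia': "dia w v \<in> Bs (i + j)" if "v \<in> Bs i" "w \<in> Bs j" for v w
        using dia[OF that(2,1)] by (simp add: add.commute)
      show "br x y \<in> T (Bs (i + j))"
        by (rule bracket_graded[OF _ _ _ xy]) (simp_all add: Bs dia[of _ i _ j] dia')
    qed
    show "nondegenerate_on (T UNIV) ?F"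
      unfolding nondegenerate_on_def using F_nd F_skew by (metis neg_equal_0_iff_equal)
    show "graded_form (\<lambda>i. T (Bs i)) ?F"
      unfolding graded_form_def using F_graded by blast
    show "bilinear_on fscale (T UNIV) fscale (T UNIV) fscale br" by (rule bilinear_bracket)
    show "bilinear_on fscale (T UNIV) fscale (T UNIV) (*) ?F" by (rule F_bilinear)
    show "graded_space fscale (T UNIV) (\<lambda>i. T (Bs i))"
      by (rule graded_space_tensor[OF fd B.graded_space])
  qed (simp_all add: subspace_T bracket_closed bracket_self jacobi F_skew[symmetric] closed)
qed


section \<open>The semi-direct product of a pre-Novikov algebra with its dual\<close>

lemma dual_space_simps:
  assumes "f \<in> dual_space s"
  shows "f (x + y) = f x + f y" "f (s c x) = c * f x"
  using assms by (simp_all add: dual_space_def Vector_Spaces.linear_iff)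

lemma (in vector_space) in_dual_space_iff:
  "f \<in> dual_space scale \<longleftrightarrow> (\<forall>x y. f (x + y) = f x + f y) \<and> (\<forall>c x. f (c *s x) = c * f x)"
  by (auto simp: dual_space_def Vector_Spaces.linear_iff vector_space_axioms vector_space_times)

lemma subspace_semidirect_space:
  assumes "vector_space s"
  shows "module.subspace (pscale s fscale) (semidirect_space s)"
proof -
  interpret vector_space s by fact
  interpret P: vector_space "pscale s fscale"
    by (rule vector_space_pscale[OF assms vector_space_fscale])
  show ?thesis
    by (auto simp: P.subspace_def semidirect_space_def in_dual_space_iff pscale_def fscale_def
        zero_prod_def algebra_simps)
qed

lemma finite_dimensional_semidirect_space:
  assumes "vector_space s" "finite_dimensional_on s UNIV"
  shows "finite_dimensional_on (pscale s fscale) (semidirect_space s)"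
  unfolding semidirect_space_def
  by (intro finite_dimensional_on_Times finite_dimensional_dual_space assms vector_space_fscale)

lemma bilinear_omega: "bilinear_on (pscale s fscale) (semidirect_space s)
    (pscale s fscale) (semidirect_space s) (*) omega"
  by (auto simp: bilinear_on_def omega_def semidirect_space_def pscale_def fscale_def
      dual_space_simps algebra_simps)

lemma omega_skew: "omega x y = - omega y x"
  by (simp add: omega_def split: prod.split)

lemma nondegenerate_omega:
  assumes "vector_space s"
  shows "nondegenerate_on (semidirect_space s) omega"
proof -
  interpret vector_space s by fact
  have left: "p = 0" if p: "p \<in> semidirect_space s"
    and orth: "\<And>q. q \<in> semidirect_space s \<Longrightarrow> omega p q = 0" for p
  proof -
    obtain a f where af: "p = (a, f)" by fastforce
    have f: "f = 0"
    proof
      fix b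
      have "(b, 0) \<in> semidirect_space s" by (simp add: semidirect_space_def in_dual_space_iff)
      then show "f b = 0 b" using orth[of "(b, 0)"] by (simp add: af omega_def)
    qed
    have "a = 0"
    proof (rule dual_space_separates[OF assms])
      fix g assume "g \<in> dual_space s"
      then show "g a = 0"
        using orth[of "(0, g)"] by (simp add: af omega_def f semidirect_space_def)
    qed
    with f af show ?thesis by (simp add: zero_prod_def)
  qed
  then show ?thesis
    unfolding nondegenerate_on_def by (metis omega_skew neg_equal_0_iff_equal)
qed

context pre_novikov_algebra
begin

lemma product_simps:
  "(x + y) \<lhd> z = x \<lhd> z + y \<lhd> z" "x \<lhd> (y + z) = x \<lhd> y + x \<lhd> z"
  "scale c x \<lhd> z = scale c (x \<lhd> z)" "x \<lhd> scale c z = scale c (x \<lhd> z)"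
  "(x + y) \<rhd> z = x \<rhd> z + y \<rhd> z" "x \<rhd> (y + z) = x \<rhd> y + x \<rhd> z"
  "scale c x \<rhd> z = scale c (x \<rhd> z)" "x \<rhd> scale c z = scale c (x \<rhd> z)"
  by (simp_all add: bilinear_onD[OF bilinear_lhd] bilinear_onD[OF bilinear_rhd])

abbreviation nov :: "'a \<Rightarrow> 'a \<Rightarrow> 'a" (infixl \<open>\<odot>\<close> 70)
  where "nov \<equiv> assoc_novikov (\<lhd>) (\<rhd>)"

text \<open>This is \<open>L\<^sub>\<rhd>(a) + R\<^sub>\<lhd>(a)\<close>, whose negative transpose is the action of \<open>a\<close> on the dual from the
  left. The next lemmas state the axioms of a bimodule before transposition.\<close>

definition M :: "'a \<Rightarrow> 'a \<Rightarrow> 'a"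
  where "M a x = a \<rhd> x + x \<lhd> a"

lemma nov_left_symmetric: "(a \<odot> b) \<odot> c - a \<odot> (b \<odot> c) = (b \<odot> a) \<odot> c - b \<odot> (a \<odot> c)"
  by (simp add: assoc_novikov_def product_simps rhd_rhd[of a b c] rhd_lhd[of a b c]
      rhd_lhd[of b a c] algebra_simps)

lemma nov_right_commutative: "(a \<odot> b) \<odot> c = (a \<odot> c) \<odot> b"
  using sum_rhd[of a b c] sum_rhd[of a c b] lhd_lhd[of a b c]
  by (simp add: assoc_novikov_def product_simps algebra_simps)

text \<open>Left symmetry of the semi-direct product when the third factor is the one in the dual.\<close>

lemma M_commutator: "M (a \<odot> b) x + M b (M a x) = M (b \<odot> a) x + M a (M b x)"
  by (simp add: assoc_novikov_def M_def product_simps rhd_rhd[of a b x] rhd_lhd[of a x b]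
      rhd_lhd[of b x a] lhd_lhd[of x a b] algebra_simps)

text \<open>Left symmetry of the semi-direct product when the first or the second factor is the one in the
  dual.\<close>

lemma M_lhd: "M b (x \<lhd> c) + (x \<lhd> c) \<lhd> b = M b x \<lhd> c + x \<lhd> (b \<odot> c)"
  using rhd_lhd[of b x c] lhd_lhd[of x b c]
  by (simp add: assoc_novikov_def M_def product_simps algebra_simps)

text \<open>Right commutativity of the semi-direct product when the second or the third factor is the one
  in the dual; when it is the first, right commutativity is the axiom \<open>lhd_lhd\<close>.\<close>

lemma M_nov: "M (a \<odot> b) x = M a (x \<lhd> b)"
  using rhd_lhd[of a x b] sum_rhd[of a b x] lhd_lhd[of x a b]
  by (simp add: assoc_novikov_def M_def product_simps algebra_simps)

lemma semidirect_mult_eq: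
  assumes "g \<in> dual_space scale"
  shows "semidirect_mult (\<lhd>) (\<rhd>) (a, f) (b, g) = (a \<odot> b, \<lambda>x. f (x \<lhd> b) - g (M a x))"
  by (rule prod_eqI)
    (simp_all add: semidirect_mult_def dual_rep_def left_mult_def right_mult_def M_def fun_eq_iff
      dual_space_simps[OF assms])

lemma semidirect_dual_part:
  assumes "f \<in> dual_space scale" "g \<in> dual_space scale"
  shows "(\<lambda>x. f (x \<lhd> b) - g (M a x)) \<in> dual_space scale"
  using assms
  by (simp add: in_dual_space_iff M_def product_simps algebra_simps)

lemma semidirect_mult_closed:
  assumes "p \<in> semidirect_space scale" "q \<in> semidirect_space scale"
  shows "semidirect_mult (\<lhd>) (\<rhd>) p q \<in> semidirect_space scale"
  using assms by (auto simp: semidirect_space_def semidirect_mult_eq semidirect_dual_part)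

lemma bilinear_semidirect_mult:
  "bilinear_on (pscale scale fscale) (semidirect_space scale) (pscale scale fscale)
    (semidirect_space scale) (pscale scale fscale) (semidirect_mult (\<lhd>) (\<rhd>))"
proof -
  have closed: "f + g \<in> dual_space scale" "fscale c f \<in> dual_space scale"
    if "f \<in> dual_space scale" "g \<in> dual_space scale" for c f g
    using that by (simp_all add: in_dual_space_iff fscale_def algebra_simps)
  note closed = closed closed(2)[unfolded fscale_def]
  show ?thesis
    by (auto simp: bilinear_on_def semidirect_space_def semidirect_mult_eq pscale_def closed
        fun_eq_iff fscale_def M_def assoc_novikov_def product_simps dual_space_simps algebra_simps)
qed

lemma semidirect_left_symmetric:
  assumes "p \<in> semidirect_space scale" "q \<in> semidirect_space scale" "r \<in> semidirect_space scale"
  defines "m \<equiv> semidirect_mult (\<lhd>) (\<rhd>)"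
  shows "m (m p q) r - m p (m q r) = m (m q p) r - m q (m p r)"
proof -
  obtain a f b g c h where p: "p = (a, f)" "q = (b, g)" "r = (c, h)"
      and dual: "f \<in> dual_space scale" "g \<in> dual_space scale" "h \<in> dual_space scale"
    using assms by (auto simp: semidirect_space_def)
  have h: "h (M (a \<odot> b) x) + h (M b (M a x)) = h (M (b \<odot> a) x) + h (M a (M b x))" for x
    using M_commutator[of a b x] by (simp flip: dual_space_simps(1)[OF dual(3)])
  have fg: "f (M b (x \<lhd> c)) = f (M b x \<lhd> c) + f (x \<lhd> (b \<odot> c)) - f ((x \<lhd> c) \<lhd> b)"
    "g (M a (x \<lhd> c)) = g (M a x \<lhd> c) + g (x \<lhd> (a \<odot> c)) - g ((x \<lhd> c) \<lhd> a)" for x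
    by (simp_all add: M_lhd eq_diff_eq flip: dual_space_simps(1)[OF dual(1)]
        dual_space_simps(1)[OF dual(2)])
  show ?thesis
    using nov_left_symmetric[of a b c] h
    by (simp add: m_def p semidirect_mult_eq semidirect_dual_part dual fun_eq_iff fg algebra_simps)
qed

lemma semidirect_right_commutative:
  assumes "p \<in> semidirect_space scale" "q \<in> semidirect_space scale" "r \<in> semidirect_space scale"
  defines "m \<equiv> semidirect_mult (\<lhd>) (\<rhd>)"
  shows "m (m p q) r = m (m p r) q"
proof -
  obtain a f b g c h where p: "p = (a, f)" "q = (b, g)" "r = (c, h)"
      and dual: "f \<in> dual_space scale" "g \<in> dual_space scale" "h \<in> dual_space scale"
    using assms by (auto simp: semidirect_space_def)
  show ?thesis
    by (simp add: m_def p semidirect_mult_eq semidirect_dual_part dual fun_eq_iff M_nov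
        nov_right_commutative[of a b c] lhd_lhd)
qed

text \<open>The terms in each of the three functionals cancel separately. This rests on the left action being
  dual to \<open>L\<^sub>\<rhd> + R\<^sub>\<lhd>\<close> and the right one to \<open>- R\<^sub>\<lhd>\<close>: what each product contributes through its
  component in \<open>A\<close> is compensated by what the others contribute through their dual components.\<close>

lemma omega_cocycle:
  assumes "p \<in> semidirect_space scale" "q \<in> semidirect_space scale" "r \<in> semidirect_space scale"
  defines "m \<equiv> semidirect_mult (\<lhd>) (\<rhd>)"
  shows "omega (m p q) r - omega (m p r + m r p) q + omega (m r q) p = 0"
proof -
  obtain a f b g c h where p: "p = (a, f)" "q = (b, g)" "r = (c, h)"
      and dual: "f \<in> dual_space scale" "g \<in> dual_space scale" "h \<in> dual_space scale"
    using assms by (auto simp: semidirect_space_def)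
  show ?thesis
    by (simp add: m_def p semidirect_mult_eq dual omega_def M_def assoc_novikov_def
        dual_space_simps[OF dual(1)] dual_space_simps[OF dual(2)] dual_space_simps[OF dual(3)])
qed

end

theorem corollary4p11:
  fixes sA :: "'k::field_char_0 \<Rightarrow> 'a::ab_group_add \<Rightarrow> 'a"
    and lhd rhd :: "'a \<Rightarrow> 'a \<Rightarrow> 'a"
    and sB :: "'k \<Rightarrow> 'b::ab_group_add \<Rightarrow> 'b"
    and Bs :: "int \<Rightarrow> 'b set"
    and dia :: "'b \<Rightarrow> 'b \<Rightarrow> 'b"
    and formB :: "'b \<Rightarrow> 'b \<Rightarrow> 'k"
  assumes "pre_novikov_algebra sA lhd rhd"
    and "finite_dimensional_on sA (UNIV :: 'a set)"
    and "quadratic_graded_right_novikov_algebra sB Bs dia formB"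
  shows "let s = pscale sA fscale;
             A' = semidirect_space sA;
             circ = semidirect_mult lhd rhd;
             tens = pure_tensor s A' sB UNIV;
             L = tensor_space s A' sB UNIV;
             Ls = (\<lambda>i. tensor_subspace s A' sB UNIV A' (Bs i));
             bracket = induced_bracket s A' sB UNIV circ dia;
             formL = tensor_form omega formB
         in quasi_frobenius_graded_lie_algebra fscale L Ls bracket formL \<and>
            (\<forall>u1\<in>A'. \<forall>u2\<in>A'. \<forall>b1 b2.
               bracket (tens u1 b1) (tens u2 b2) =
                 tens (circ u1 u2) (dia b1 b2) - tens (circ u2 u1) (dia b2 b1) \<and>
               formL (tens u1 b1) (tens u2 b2) = omega u1 u2 * formB b1 b2)"
proof -
  interpret A: pre_novikov_algebra sA lhd rhd by fact
  interpret B: quadratic_graded_right_novikov_algebra sB Bs dia formB by fact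
  let ?s = "pscale sA fscale :: 'k \<Rightarrow> 'a \<times> ('a \<Rightarrow> 'k) \<Rightarrow> _" and ?U = "semidirect_space sA"
    and ?circ = "semidirect_mult lhd rhd :: 'a \<times> ('a \<Rightarrow> 'k) \<Rightarrow> _"
  have "vector_space ?s"
    by (rule vector_space_pscale[OF A.vector_space_axioms vector_space_fscale])
  interpret novikov_tensor ?s ?U sB ?circ dia
    by (intro novikov_tensor.intro tensor_product.intro tensor_product_axioms.intro
        novikov_tensor_axioms.intro \<open>vector_space ?s\<close> B.vector_space_axioms
        subspace_semidirect_space A.vector_space_axioms A.semidirect_mult_closed
        A.bilinear_semidirect_mult A.semidirect_left_symmetric A.semidirect_right_commutative
        B.bilinear_dia B.right_symmetric B.left_commutative)
  have quasi: "quasi_frobenius_graded_lie_algebra fscale (T UNIV) (\<lambda>i. T (Bs i)) br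
      (tensor_form omega formB)"
    by (rule quasi_frobenius_tensor_product[OF novikov_tensor_axioms assms(3)
          finite_dimensional_semidirect_space[OF A.vector_space_axioms assms(2)] bilinear_omega
          nondegenerate_omega[OF A.vector_space_axioms] omega_skew A.omega_cocycle])
  have form_tens: "tensor_form omega formB (tens u1 b1) (tens u2 b2) = omega u1 u2 * formB b1 b2"
    if "u1 \<in> ?U" "u2 \<in> ?U" for u1 u2 b1 b2
    unfolding tensor_form_def
    by (rule tensor_ext_tens[OF quadrilinear_prod[OF bilinear_omega B.bilinear_form] that])
  show ?thesis
    unfolding Let_def by (intro conjI ballI allI quasi bracket_tens form_tens)
qed

end
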